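(* For $m\ge 3$ let $B_m$ be the 2-state Mealy automaton over the $m$-symbol alphabet $\{x_0,\dots,x_{m-1}\}$ whose automatic transformations have the unrolled forms $$f_0=(f_0,f_0,f_1,f_0,\dots,f_0,f_0)(x_1,x_0,x_2,x_3,\dots,x_{m-2},x_{m-1}),$$ $$f_1=(f_0,f_1,f_1,f_1,\dots,f_1,f_1)(x_1,x_2,x_3,x_4,\dots,x_{m-1},x_{m-1}).$$ Then: (1) The semigroup $S_{B_m}$ generated by $f_0,f_1$ has the following semigroup presentation on generators $f_0,f_1$. For $m=3$: $f_1^3=f_0f_1^2$ and $f_1f_0f_1=f_0^2f_1$. For $m=4$: $f_1^4=f_1f_0f_1^2$ and $f_1f_0^{p_1}f_1f_0f_1=f_1f_0^{p_1+2}f_1$ for all $p_1\ge 0$. For $m\ge5$: for all integers $p_1,\dots,p_{m-3}\ge 0$, $$\prod_{i=1}^{m-4}\left(f_1f_0^{p_i}\right)f_1^4=\prod_{i=1}^{m-4}\left(f_1f_0^{p_i}\right)f_1f_0f_1^2,\qquad \prod_{i=1}^{m-3}\left(f_1f_0^{p_i}\right)f_1f_0f_1=\prod_{i=1}^{m-3}\left(f_1f_0^{p_i}\right)f_0^2f_1 .$$ All semigroups $S_{B_m}$ with $m\ge 4$ are infinitely presented (admit no finite presentation). (2) For every $m\ge 3$ and every $n\ge 1$ the growth function of $B_m$ satisfies $$\gamma_{B_m}(n)=\sum_{i=0}^{m-2}\binom{n}{i}+\sum_{i=0}^{\left[\frac{n-m+1}{2}\right]}\binom{n-2i-1}{m-2}=\sum_{i=0}^{m-2}\binom{n}{i}+\sum_{i\ge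 0}\binom{n-2i-1}{m-2}.$$
   Context: A Mealy automaton with states $q_0,\dots,q_{n-1}$ and input/output alphabet $X_m=\{x_0,\dots,x_{m-1}\}$ has a transition function $\pi:X_m\times Q\to Q$ and an output function $\lambda:X_m\times Q\to X_m$. The state $q_i$ defines an automatic transformation $f_i=f_{q_i}$ of the set of finite (or infinite) words over $X_m$: on input $x u$ ($x$ a letter) it outputs $\lambda(x,q_i)$ followed by $f_{\pi(x,q_i)}(u)$. The unrolled form $f_i=(g_0,\dots,g_{m-1})(y_0,\dots,y_{m-1})$ means $f_i(x_ju)=y_j\,g_j(u)$ for every letter $x_j$ and word $u$. Products of transformations are compositions applied from right to left: $(fg)(u)=f(g(u))$; products $\prod_{i=1}^{r}w_i$ are written $w_1w_2\cdots w_r$. Explicitly for $B_m$: $f_0$ exchanges the letters $x_0,x_1$, fixes the other letters, and passes to $f_1$ after reading $x_2$ and to $f_0$ after reading any other letter; $f_1$ maps $x_i\mapsto x_{\min(i+1,m-1)}$ and passes to $f_0$ after reading $x_0$ and to $f_1$ after reading any other letter. $S_A$ is the semigroup generated by the automatic transformations under composition. The growth function of $A$ is $\gamma_A(n)=|Q_{A^{(n)}}|$, the number of states of the minimal automaton equivalent to the $n$-th power $A^n$ (sequential application); equivalently, for $n\ge1$, the number of distinct transformations of the form $f_{i_1}f_{i_2}\cdots f_{i_n}$ (products of exactly $n$ generators). $[r]$ denotes the integer part of the real number $r$; a sum with negative upper limit is empty; $\binom{n}{k}=0$ if $k>n$ or $n<0$. *)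

theory Defs
  imports Complex_Main "HOL-Library.FuncSet"
begin

section \<open>Mealy automata\<close>

text \<open>The input/output alphabet \<open>X_m = {x_0, ..., x_(m-1)}\<close> is encoded as \<open>{..<m}\<close>.\<close>

record 'q mealy =
  alph :: nat
  states :: "'q set"
  trans :: "nat \<Rightarrow> 'q \<Rightarrow> 'q"
  out :: "nat \<Rightarrow> 'q \<Rightarrow> nat"

definition mealy_automaton :: "'q mealy \<Rightarrow> bool" where
  "mealy_automaton A \<longleftrightarrow>
     finite (states A) \<and> states A \<noteq> {} \<and>
     (\<forall>x<alph A. \<forall>q\<in>states A. trans A x q \<in> states A \<and> out A x q < alph A)"

definition input_words :: "'q mealy \<Rightarrow> nat list set" where
  "input_words A = lists {..<alph A}"

primrec run :: "'q mealy \<Rightarrow> 'q \<Rightarrow> nat list \<Rightarrow> nat list" where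
  "run A q [] = []"
| "run A q (x # u) = out A x q # run A (trans A x q) u"

text \<open>The automatic transformation defined by a state is an extensional function on the finite
  words over the alphabet, so that HOL equality is equality of transformations of that set.\<close>

definition transf :: "'q mealy \<Rightarrow> 'q \<Rightarrow> nat list \<Rightarrow> nat list" where
  "transf A q = restrict (run A q) (input_words A)"

text \<open>\<open>compose\<close> is composition from right to left: \<open>(fg)(u) = f (g u)\<close>.\<close>

inductive_set automaton_semigroup :: "'q mealy \<Rightarrow> (nat list \<Rightarrow> nat list) set"
  for A :: "'q mealy" where
  gen: "q \<in> states A \<Longrightarrow> transf A q \<in> automaton_semigroup A"
| mult: "f \<in> automaton_semigroup A \<Longrightarrow> g \<in> automaton_semigroup A \<Longrightarrow>
    compose (input_words A) f g \<in> automaton_semigroup A"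

section \<open>Powers, minimal automata and growth\<close>

text \<open>The state \<open>[q_1, ..., q_n]\<close> of the power \<open>A^n\<close> applies \<open>q_n\<close> first and \<open>q_1\<close> last, so that
  it defines the product \<open>f_{q_1} \<cdots> f_{q_n}\<close>.\<close>

primrec pow_out :: "'q mealy \<Rightarrow> nat \<Rightarrow> 'q list \<Rightarrow> nat" where
  "pow_out A x [] = x"
| "pow_out A x (q # qs) = out A (pow_out A x qs) q"

primrec pow_trans :: "'q mealy \<Rightarrow> nat \<Rightarrow> 'q list \<Rightarrow> 'q list" where
  "pow_trans A x [] = []"
| "pow_trans A x (q # qs) = trans A (pow_out A x qs) q # pow_trans A x qs"

definition mealy_power :: "'q mealy \<Rightarrow> nat \<Rightarrow> 'q list mealy" where
  "mealy_power A n =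
     \<lparr>alph = alph A, states = {qs. set qs \<subseteq> states A \<and> length qs = n},
      trans = pow_trans A, out = pow_out A\<rparr>"

definition mealy_equivalent :: "'p mealy \<Rightarrow> 'q mealy \<Rightarrow> bool" where
  "mealy_equivalent A B \<longleftrightarrow>
     alph A = alph B \<and> transf A ` states A = transf B ` states B"

text \<open>Every finite automaton is isomorphic to one whose states are natural numbers, so it suffices
  to compare with automata of that type.\<close>

definition minimal_automaton :: "'q mealy \<Rightarrow> nat mealy \<Rightarrow> bool" where
  "minimal_automaton A B \<longleftrightarrow>
     mealy_automaton B \<and> mealy_equivalent B A \<and>
     (\<forall>C :: nat mealy. mealy_automaton C \<and> mealy_equivalent C A \<longrightarrow>
        card (states B) \<le> card (states C))"

text \<open>The minimal automaton is unique up to isomorphism, so its number of states does not depend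
  on the choice.\<close>

definition growth :: "'q mealy \<Rightarrow> nat \<Rightarrow> nat" where
  "growth A n = card (states (SOME B. minimal_automaton (mealy_power A n) B))"

section \<open>Semigroup presentations\<close>

text \<open>The free semigroup on \<open>Y\<close> is the set of nonempty words over \<open>Y\<close>.\<close>

definition free_semigroup :: "'a set \<Rightarrow> 'a list set" where
  "free_semigroup Y = lists Y - {[]}"

inductive generated_congruence ::
  "'a set \<Rightarrow> ('a list \<times> 'a list) set \<Rightarrow> 'a list \<Rightarrow> 'a list \<Rightarrow> bool"
  for Y :: "'a set" and R :: "('a list \<times> 'a list) set" where
  rel: "(u, v) \<in> R \<Longrightarrow> generated_congruence Y R u v"
| refl: "u \<in> free_semigroup Y \<Longrightarrow> generated_congruence Y R u u"
| sym: "generated_congruence Y R u v \<Longrightarrow> generated_congruence Y R v u"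
| trans: "generated_congruence Y R u v \<Longrightarrow> generated_congruence Y R v w \<Longrightarrow>
    generated_congruence Y R u w"
| mult: "generated_congruence Y R u v \<Longrightarrow> generated_congruence Y R u' v' \<Longrightarrow>
    generated_congruence Y R (u @ u') (v @ v')"

definition semigroup_on :: "'s set \<Rightarrow> ('s \<Rightarrow> 's \<Rightarrow> 's) \<Rightarrow> bool" where
  "semigroup_on S mul \<longleftrightarrow>
     (\<forall>a\<in>S. \<forall>b\<in>S. mul a b \<in> S) \<and>
     (\<forall>a\<in>S. \<forall>b\<in>S. \<forall>c\<in>S. mul (mul a b) c = mul a (mul b c))"

text \<open>The value of the empty word is irrelevant: only nonempty words are evaluated.\<close>

fun word_value :: "('s \<Rightarrow> 's \<Rightarrow> 's) \<Rightarrow> ('a \<Rightarrow> 's) \<Rightarrow> 'a list \<Rightarrow> 's" where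
  "word_value mul \<phi> [] = undefined"
| "word_value mul \<phi> [a] = \<phi> a"
| "word_value mul \<phi> (a # b # w) = mul (\<phi> a) (word_value mul \<phi> (b # w))"

text \<open>\<open>\<langle>Y | R\<rangle>\<close> presents \<open>S\<close> via \<open>\<phi>\<close>: the homomorphism from the free semigroup on \<open>Y\<close> to \<open>S\<close>
  extending \<open>\<phi>\<close> is onto, and its kernel is the congruence generated by \<open>R\<close>.\<close>

definition semigroup_presentation ::
  "'s set \<Rightarrow> ('s \<Rightarrow> 's \<Rightarrow> 's) \<Rightarrow> 'a set \<Rightarrow> ('a \<Rightarrow> 's) \<Rightarrow> ('a list \<times> 'a list) set \<Rightarrow> bool" where
  "semigroup_presentation S mul Y \<phi> R \<longleftrightarrow>
     semigroup_on S mul \<and>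
     \<phi> ` Y \<subseteq> S \<and>
     R \<subseteq> free_semigroup Y \<times> free_semigroup Y \<and>
     word_value mul \<phi> ` free_semigroup Y = S \<and>
     (\<forall>u\<in>free_semigroup Y. \<forall>v\<in>free_semigroup Y.
        word_value mul \<phi> u = word_value mul \<phi> v \<longleftrightarrow> generated_congruence Y R u v)"

definition finitely_presented :: "'s set \<Rightarrow> ('s \<Rightarrow> 's \<Rightarrow> 's) \<Rightarrow> bool" where
  "finitely_presented S mul \<longleftrightarrow>
     (\<exists>(Y :: nat set) \<phi> R. finite Y \<and> finite R \<and> semigroup_presentation S mul Y \<phi> R)"

section \<open>The automata \<open>B_m\<close>\<close>

definition B_trans :: "nat \<Rightarrow> nat \<Rightarrow> nat" where
  "B_trans x q =
     (if q = 0 then (if x = 2 then 1 else 0)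
      else (if x = 0 then 0 else 1))"

definition B_out :: "nat \<Rightarrow> nat \<Rightarrow> nat \<Rightarrow> nat" where
  "B_out m x q =
     (if q = 0 then (if x = 0 then 1 else if x = 1 then 0 else x)
      else min (x + 1) (m - 1))"

definition B :: "nat \<Rightarrow> nat mealy" where
  "B m = \<lparr>alph = m, states = {0, 1}, trans = B_trans, out = B_out m\<rparr>"

text \<open>The word \<open>\<Prod>_{i=1}^r f_1 f_0^{p_i}\<close>, with the symbols \<open>f_0\<close>, \<open>f_1\<close> encoded as 0, 1;
  it is empty for \<open>r = 0\<close>.\<close>

definition prod_word :: "(nat \<Rightarrow> nat) \<Rightarrow> nat \<Rightarrow> nat list" where
  "prod_word p r = concat (map (\<lambda>i. [1] @ replicate (p i) 0) [1..<r + 1])"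

text \<open>The library's \<open>choose\<close> takes a natural number as its upper argument, which here may become
  negative.\<close>

definition ibinom :: "int \<Rightarrow> nat \<Rightarrow> nat" where
  "ibinom n k = (if n < 0 then 0 else nat n choose k)"

end

theory Submission
  imports Defs
begin

text \<open>A letter travels through a word from right to left. As long as it is \<open>x_0\<close> or \<open>x_1\<close>, a symbol
  0 exchanges the two, and a symbol 1 turns \<open>x_0\<close> into \<open>x_1\<close> and is erased, or turns \<open>x_1\<close> into
  \<open>x_2\<close> and stays. The letter \<open>x_2\<close> turns the symbols 0 into 1 up to the next 1, and larger
  letters change nothing but are increased by each 1, up to \<open>x_(m-1)\<close>.

  The relations preserve the first \<open>m - 3\<close> symbols 1 of a word; behind them one may calculate
  with the two relations of the case \<open>m = 3\<close>, which delete all further symbols 1 except the last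
  one and the nearest one in front of it at an even gap. So every word is congruent to a normal
  form: a word with at most \<open>m - 2\<close> symbols 1, or one with \<open>m - 1\<close> of them and an even last gap.
  The congruence is a bisimulation, hence the relations hold. Conversely, a normal form can be read
  off from its transformation: alternating the letters \<open>x_0\<close> and \<open>x_1\<close> erases the trailing
  symbols 1 one at a time while the output letters count the remaining ones.\<close>

text \<open>The obstacle is saturation: output letters stop at \<open>x_(m-1)\<close>, so they count
  symbols 1 only up to \<open>m - 2\<close>, and the lengths of the gaps never show directly. A gap
  is therefore measured by time. A word is cut into a prefix with few enough symbols 1 to be counted
  exactly and a rest that ends in two adjacent symbols 1 or is a single 1; the length of the rest is
  the number of letters needed to erase it. Moving the cut to the left, over one symbol 1 at a time,
  yields all gaps. An even last gap in a normal form with \<open>m - 1\<close> symbols 1 is what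
  makes both \<open>x_0\<close> and \<open>x_1\<close> saturate, which never happens with
  \<open>m - 2\<close> of them. Uniqueness of normal forms thus comes from the action, not from
  confluence of the relations. The relations need \<open>m - 3\<close> symbols 1 on their left, at
  arbitrary distances: hence the infinite families, of which a finite part cannot reach across a
  long gap.\<close>

declare One_nat_def [simp del]

section \<open>Words over {0, 1} as states of the powers of \<open>B m\<close>\<close>

definition act :: "nat \<Rightarrow> nat list \<Rightarrow> nat list \<Rightarrow> nat list" where
  "act m w = foldr (run (B m)) w"

abbreviation letter_out :: "nat \<Rightarrow> nat \<Rightarrow> nat list \<Rightarrow> nat" where
  "letter_out m \<equiv> pow_out (B m)"

abbreviation next_word :: "nat \<Rightarrow> nat \<Rightarrow> nat list \<Rightarrow> nat list" where
  "next_word m \<equiv> pow_trans (B m)"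

abbreviation binary :: "nat list \<Rightarrow> bool" where
  "binary w \<equiv> set w \<subseteq> {0, 1}"

abbreviation ones :: "nat list \<Rightarrow> nat" where
  "ones w \<equiv> count_list w 1"

abbreviation zs :: "nat \<Rightarrow> nat list" where
  "zs n \<equiv> replicate n 0"

lemma B_simps [simp]:
  "alph (B m) = m" "states (B m) = {0, 1}" "trans (B m) = B_trans" "out (B m) = B_out m"
  by (simp_all add: B_def)

lemma input_words_B [simp]: "input_words (B m) = lists {..<m}"
  by (simp add: input_words_def)

lemma pow_out_append [simp]: "pow_out A x (u @ v) = pow_out A (pow_out A x v) u"
  by (induction u) auto

lemma pow_trans_append [simp]:
  "pow_trans A x (u @ v) = pow_trans A (pow_out A x v) u @ pow_trans A x v"
  by (induction u) auto

lemma length_pow_trans [simp]: "length (pow_trans A x w) = length w"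
  by (induction w) auto

lemma binary_next_word: "binary w \<Longrightarrow> binary (next_word m x w)"
  by (induction w) (auto simp: B_trans_def)

lemma binary_zs [simp]: "binary (zs n)"
  by auto

lemma ones_replicate [simp]: "count_list (replicate n a) b = (if a = b then n else 0)"
  by (induction n) auto

lemma letter_out_less: "x < m \<Longrightarrow> 3 \<le> m \<Longrightarrow> letter_out m x w < m"
  by (induction w) (auto simp: B_out_def)

section \<open>Action of words on letters\<close>

lemma letter_out_zs_low [simp]: "x < 2 \<Longrightarrow> letter_out m x (zs c) = (x + c) mod 2"
proof (induction c)
  case (Suc c)
  have "(x + c) mod 2 = 0 \<or> (x + c) mod 2 = 1" by auto
  with Suc show ?case by (auto simp: B_out_def) presburger+
qed auto

lemma next_word_zs_low [simp]: "x < 2 \<Longrightarrow> next_word m x (zs c) = zs c"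
  by (induction c) (auto simp: B_trans_def)

lemma letter_out_zs_high [simp]: "2 \<le> x \<Longrightarrow> letter_out m x (zs c) = x"
  by (induction c) (auto simp: B_out_def)

lemma next_word_zs_two [simp]: "next_word m 2 (zs c) = replicate c 1"
  by (induction c) (auto simp: B_trans_def)

lemma letter_out_high:
  "\<lbrakk>binary w; 2 \<le> x; x < m\<rbrakk> \<Longrightarrow> letter_out m x w = min (m - 1) (x + ones w)"
  by (induction w) (auto simp: B_out_def min_def)

lemma next_word_high: "\<lbrakk>binary w; 3 \<le> x; x < m\<rbrakk> \<Longrightarrow> next_word m x w = w"
  by (induction w) (auto simp: B_trans_def letter_out_high)

text \<open>For \<open>m \<ge> 4\<close> the last 1 turns \<open>x_2\<close> into
  \<open>x_3\<close>, and letters above \<open>x_2\<close> change nothing. For \<open>m = 3\<close>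
  the letter would stay \<open>x_2\<close> and go on filling zeros.\<close>

lemma next_word_two_last:
  assumes "4 \<le> m" "binary w" "w = [] \<or> last w = 1" "2 \<le> x" "x < m"
  shows "next_word m x w = w"
  using assms
  by (cases w rule: rev_cases) (auto simp: next_word_high B_trans_def B_out_def)

text \<open>A nonempty \<open>A\<close> contains a 1, so \<open>ones A + 3 \<le> m\<close> forces
  \<open>m \<ge> 4\<close>, and its last 1 lifts the letter above \<open>x_2\<close> before a zero
  of \<open>A\<close> is met. The last symbol of \<open>y\<close> meets \<open>x_2\<close> itself
  and becomes or stays 1.\<close>

lemma next_word_two_fill:
  assumes "3 \<le> m" "binary A" "binary y" "A = [] \<or> last A = 1" "ones A + 3 \<le> m"
  obtains y' where "next_word m 2 (A @ y) = A @ y'" "length y' = length y"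
    "binary y'" "y = [] \<or> last y' = 1"
proof -
  have A: "next_word m x A = A" if "2 \<le> x" "x < m" for x
  proof (cases "A = []")
    case False
    then have "ones A \<ge> 1" using assms(4)
      by (metis count_list_0_iff last_in_set less_one not_less)
    then show ?thesis using next_word_two_last[of m A x] assms that by auto
  qed auto
  define x where "x = letter_out m 2 y"
  have x: "2 \<le> x" "x < m" using letter_out_high[of y 2 m] assms by (auto simp: x_def)
  show ?thesis
  proof (rule that[of "next_word m 2 y"])
    show "next_word m 2 (A @ y) = A @ next_word m 2 y" using A[OF x] by (simp add: x_def)
    show "binary (next_word m 2 y)" using assms(3) by (rule binary_next_word)
    show "y = [] \<or> last (next_word m 2 y) = 1" using assms(3)
      by (cases y rule: rev_cases) (auto simp: B_trans_def)
  qed auto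
qed

text \<open>Reading a letter \<open>x \<in> {x_0, x_1}\<close>: the trailing zeros only exchange \<open>x_0\<close> and \<open>x_1\<close>, so the
  last symbol 1 is reached with the letter \<open>x_1\<close> and kept, or with \<open>x_0\<close> and then erased.\<close>

lemma keep_last:
  assumes "3 \<le> m" "x < 2" "odd (x + c)"
  shows "letter_out m x (w @ [1] @ zs c) = letter_out m 2 w"
    and "next_word m x (w @ [1] @ zs c) = next_word m 2 w @ [1] @ zs c"
proof -
  have parity: "(x + c) mod 2 = 1" using assms(3) by presburger
  have "letter_out m x ([1] @ zs c) = 2" "next_word m x ([1] @ zs c) = [1] @ zs c"
    using assms by (simp_all add: B_out_def B_trans_def parity)
  then show "letter_out m x (w @ [1] @ zs c) = letter_out m 2 w"
    and "next_word m x (w @ [1] @ zs c) = next_word m 2 w @ [1] @ zs c"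
    by (metis pow_out_append, metis pow_trans_append)
qed

lemma erase_last:
  assumes "3 \<le> m" "x < 2" "even (x + c)"
  shows "letter_out m x (w @ [1] @ zs c) = letter_out m 1 w"
    and "next_word m x (w @ [1] @ zs c) = next_word m 1 w @ zs (Suc c)"
  using assms by (auto simp: B_out_def B_trans_def)

lemma letter_out_low_le:
  assumes "binary w" "x < 2"
  shows "letter_out m x w \<le> 1 + ones w"
  using assms(1) by (induction w) (use assms(2) in \<open>auto simp: B_out_def\<close>)

definition act_eq :: "nat \<Rightarrow> nat list \<Rightarrow> nat list \<Rightarrow> bool" where
  "act_eq m v w \<longleftrightarrow> (\<forall>u\<in>lists {..<m}. act m v u = act m w u)"

lemma act_Nil [simp]: "act m w [] = []"
  by (induction w) (auto simp: act_def)

lemma act_Cons [simp]: "act m w (x # u) = letter_out m x w # act m (next_word m x w) u"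
  by (induction w arbitrary: x u) (auto simp: act_def)

lemma act_eqD:
  assumes "act_eq m v w" "x < m"
  shows "letter_out m x v = letter_out m x w" "act_eq m (next_word m x v) (next_word m x w)"
proof -
  have *: "act m v (x # u) = act m w (x # u)" if "u \<in> lists {..<m}" for u
    using that assms unfolding act_eq_def by (metis Cons_in_lists_iff lessThan_iff)
  show "letter_out m x v = letter_out m x w" using *[of "[]"] by simp
  show "act_eq m (next_word m x v) (next_word m x w)"
    unfolding act_eq_def using * by simp
qed

section \<open>Reading off a word from its transformation\<close>

lemma split_zeros:
  "binary w \<Longrightarrow> \<exists>A b. w = A @ zs b \<and> (A = [] \<or> last A = 1)"
proof (induction w rule: rev_induct)
  case (snoc a w)
  then obtain A b where A: "w = A @ zs b" "A = [] \<or> last A = 1" by auto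
  show ?case
  proof (cases "a = 0")
    case True
    then have "w @ [a] = A @ zs (Suc b)" using A by (simp add: replicate_append_same)
    then show ?thesis using A by blast
  next
    case False
    then have "w @ [a] = (w @ [a]) @ zs 0 \<and> last (w @ [a]) = 1" using snoc.prems by simp
    then show ?thesis by blast
  qed
qed simp

lemma split_last_one:
  assumes "binary w" "ones w = Suc s"
  obtains v c where "w = v @ [1] @ zs c" "binary v" "ones v = s"
proof -
  obtain A b where A: "w = A @ zs b" "A = [] \<or> last A = 1" using split_zeros assms(1) by blast
  then obtain v where "A = v @ [1]" using assms(2) by (cases A rule: rev_cases) auto
  then show ?thesis using that A assms by auto
qed

text \<open>This shape survives the erasure of its last 1: the letter then meets the adjacent 1 as
  \<open>x_1\<close>, keeps it and goes on as \<open>x_2\<close>, which makes the remaining part end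
  in 1 again.\<close>

definition filled :: "nat list \<Rightarrow> bool" where
  "filled z \<longleftrightarrow> binary z \<and> (z = [1] \<or> (\<exists>y. z = y @ [1, 1]))"

text \<open>The bound keeps counting exact: a letter entering \<open>A\<close> as \<open>x_1\<close>
  leaves it as \<open>x_(1 + ones A)\<close>, strictly below the cap \<open>x_(m-1)\<close>, and one
  entering as \<open>x_2\<close> or higher leaves it as a larger letter.\<close>

definition observable :: "nat \<Rightarrow> nat list \<Rightarrow> bool" where
  "observable m A \<longleftrightarrow> binary A \<and> (A = [] \<or> last A = 1) \<and> ones A + 3 \<le> m"

lemma observableD:
  assumes "observable m A"
  shows "binary A" "A = [] \<or> last A = 1" "ones A + 3 \<le> m" "3 \<le> m"
  using assms by (auto simp: observable_def)

lemma letter_out_observable: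
  assumes "observable m A" "x < 2" "even (x + e)"
  shows "letter_out m x (A @ [1] @ zs e) = 1 + ones A"
proof -
  note A = observableD[OF assms(1)]
  have "letter_out m 1 A = 1 + ones A"
  proof (cases A rule: rev_cases)
    case (snoc y a)
    then have [simp]: "a = 1" using A by auto
    have "letter_out m 1 (y @ [1] @ zs 0) = letter_out m 2 y"
      using A by (intro keep_last) auto
    then show ?thesis using letter_out_high[of y 2 m] A snoc by simp
  qed simp
  then show ?thesis using erase_last(1)[OF A(4) assms(2,3)] by simp
qed

text \<open>The last 1 is erased by \<open>x_0\<close>, the adjacent 1 is kept by
  \<open>x_1\<close>, and \<open>x_2\<close> makes \<open>y\<close> end in 1. The filled part loses
  one symbol and the trailing zeros gain one, so the next erasing letter is the other one of
  \<open>x_0\<close> and \<open>x_1\<close>.\<close>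

lemma filled_erase:
  assumes "observable m A" "binary y" "x < 2" "even (x + e)"
  obtains z where
    "next_word m x (A @ (y @ [1, 1]) @ zs e) = A @ z @ zs (Suc e)"
    "filled z" "length z = Suc (length y)"
    "letter_out m x (A @ (y @ [1, 1]) @ zs e) = min (m - 1) (2 + ones A + ones y)"
proof -
  note A = observableD[OF assms(1)]
  obtain y' where y': "next_word m 2 (A @ y) = A @ y'" "length y' = length y" "binary y'"
    "y = [] \<or> last y' = 1"
    using next_word_two_fill[OF A(4,1) assms(2) A(2,3)] by metis
  have 1: "letter_out m 1 ((A @ y) @ [1]) = letter_out m 2 (A @ y)"
    "next_word m 1 ((A @ y) @ [1]) = next_word m 2 (A @ y) @ [1]"
    using keep_last[of m 1 0 "A @ y"] A(4) by auto
  show ?thesis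
  proof (rule that[of "y' @ [1]"])
    have split: "A @ (y @ [1, 1]) @ zs e = ((A @ y) @ [1]) @ [1] @ zs e" by simp
    show "next_word m x (A @ (y @ [1, 1]) @ zs e) = A @ (y' @ [1]) @ zs (Suc e)"
      unfolding split erase_last(2)[OF A(4) assms(3,4)] 1 y' by simp
    show "letter_out m x (A @ (y @ [1, 1]) @ zs e) = min (m - 1) (2 + ones A + ones y)"
      unfolding split erase_last(1)[OF A(4) assms(3,4)] 1
      using letter_out_high[of "A @ y" 2 m] A assms(2) by (simp add: ac_simps)
    show "filled (y' @ [1])"
      using y' by (cases y' rule: rev_cases) (auto simp: filled_def)
  qed (use y' in simp)
qed

text \<open>Erasing is a countdown: the output is \<open>1 + ones A\<close> when only
  \<open>[1]\<close> is left and at least \<open>2 + ones A\<close> before, so both words reach this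
  point at the same time.\<close>

lemma filled_length_eq:
  assumes "observable m A" "observable m A'" "ones A = ones A'"
  shows "\<lbrakk>act_eq m (A @ z @ zs e) (A' @ z' @ zs e'); filled z; filled z'; even e = even e'\<rbrakk>
    \<Longrightarrow> length z = length z'"
proof (induction "length z" arbitrary: z z' e e' rule: less_induct)
  case less
  \<comment> \<open>The letter that crosses \<open>e\<close> zeros, and likewise \<open>e'\<close>
    zeros, to arrive as \<open>x_0\<close> at the last 1 of either word.\<close>
  define x where "x = e mod 2"
  have x: "x < 2" "even (x + e)" "even (x + e')" "x < m"
    using less.prems(4) observableD(4)[OF assms(1)] by (auto simp: x_def)
  note eq = act_eqD[OF less.prems(1) x(4)]
  have le: "ones A + 3 \<le> m" "ones A' + 3 \<le> m" using assms observableD(3) by blast+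
  show ?case
  proof (cases "z = [1]")
    case z: True
    show ?thesis
    proof (cases "z' = [1]")
      case False
      then obtain y where y: "z' = y @ [1, 1]" "binary y" using less.prems(3) by (auto simp: filled_def)
      show ?thesis
        using filled_erase[OF assms(2) y(2) x(1,3)] letter_out_observable[OF assms(1) x(1,2)]
          eq(1) y z assms(3) le by fastforce
    qed (use z in simp)
  next
    case False
    then obtain y where y: "z = y @ [1, 1]" "binary y" using less.prems(2) by (auto simp: filled_def)
    obtain w where w: "next_word m x (A @ z @ zs e) = A @ w @ zs (Suc e)"
      "filled w" "length w = Suc (length y)"
      "letter_out m x (A @ z @ zs e) = min (m - 1) (2 + ones A + ones y)"
      using filled_erase[OF assms(1) y(2) x(1,2)] y(1) by metis
    show ?thesis
    proof (cases "z' = [1]")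
      case True
      then show ?thesis
        using letter_out_observable[OF assms(2) x(1,3)] w(4) eq(1) assms(3) le by fastforce
    next
      case False
      then obtain y' where y': "z' = y' @ [1, 1]" "binary y'"
        using less.prems(3) by (auto simp: filled_def)
      obtain w' where w': "next_word m x (A' @ z' @ zs e') = A' @ w' @ zs (Suc e')"
        "filled w'" "length w' = Suc (length y')"
        using filled_erase[OF assms(2) y'(2) x(1,3)] y'(1) by metis
      have "length w = length w'"
        using less.hyps[of w "Suc e" w' "Suc e'"] eq(2) w w' y(1) less.prems(4) by simp
      then show ?thesis using w w' y y' by simp
    qed
  qed
qed

lemma observable_Nil [simp]: "observable m [] \<longleftrightarrow> 3 \<le> m"
  by (simp add: observable_def)

text \<open>Running the countdown to its end turns every erased symbol into a trailing zero, so that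
  the number of zeros records the total length.\<close>

lemma filled_to_zeros:
  assumes "3 \<le> m"
  shows "\<lbrakk>act_eq m (z @ zs e) (z' @ zs e'); filled z; filled z'; even e = even e';
    length z = length z'\<rbrakk> \<Longrightarrow> act_eq m (zs (length z + e)) (zs (length z + e'))"
proof (induction "length z" arbitrary: z z' e e' rule: less_induct)
  case less
  define x where "x = e mod 2"
  have x: "x < 2" "even (x + e)" "even (x + e')" "x < m"
    using less.prems(4) assms by (auto simp: x_def)
  note eq = act_eqD[OF less.prems(1) x(4)]
  have O: "observable m []" using assms by simp
  show ?case
  proof (cases "z = [1]")
    case True
    then have "z' = [1]" using less.prems(3,5) by (auto simp: filled_def)
    then show ?thesis
      using eq(2) erase_last(2)[OF assms x(1,2), of "[]"] erase_last(2)[OF assms x(1,3), of "[]"] True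
      by simp
  next
    case False
    then obtain y where y: "z = y @ [1, 1]" "binary y" using less.prems(2) by (auto simp: filled_def)
    obtain w where w: "next_word m x (z @ zs e) = w @ zs (Suc e)"
      "filled w" "length w = Suc (length y)"
      using filled_erase[OF O y(2) x(1,2)] y(1) by (metis append_Nil)
    have "z' \<noteq> [1]" using y less.prems(5) by auto
    then obtain y' where y': "z' = y' @ [1, 1]" "binary y'"
      using less.prems(3) by (auto simp: filled_def)
    obtain w' where w': "next_word m x (z' @ zs e') = w' @ zs (Suc e')"
      "filled w'" "length w' = Suc (length y')"
      using filled_erase[OF O y'(2) x(1,3)] y'(1) by (metis append_Nil)
    have "act_eq m (zs (length w + Suc e)) (zs (length w + Suc e'))"
      using eq(2) w w' y y' less.prems(4,5)
      by (intro less.hyps[of w "Suc e" w' "Suc e'"]) simp_all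
    then show ?thesis using w y by simp
  qed
qed

lemma filled_replicate:
  assumes "0 < n"
  shows "filled (replicate n 1)"
proof -
  obtain k where k: "n = Suc k" using assms gr0_implies_Suc by blast
  show ?thesis
  proof (cases k)
    case (Suc j)
    then have "replicate n 1 = replicate j (1::nat) @ [1, 1]"
      using k by (simp add: replicate_append_same replicate_app_Cons_same)
    then show ?thesis by (auto simp: filled_def)
  qed (use k in \<open>simp add: filled_def\<close>)
qed

text \<open>The letter \<open>x_2\<close> turns zeros into symbols 1, and a word of symbols 1 is
  filled, so the countdown measures it.\<close>

lemma act_eq_zeros:
  assumes "3 \<le> m" "0 < n" "0 < n'" "act_eq m (zs n) (zs n')"
  shows "n = n'"
proof -
  have "act_eq m (replicate n 1) (replicate n' 1)"
    using act_eqD(2)[OF assms(4), of 2] assms(1) by simp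
  then show ?thesis
    using filled_length_eq[of m "[]" "[]" "replicate n 1" 0 "replicate n' 1" 0] assms filled_replicate
    by simp
qed

lemma filled_prefix: "observable m A \<Longrightarrow> filled z \<Longrightarrow> filled (A @ z)"
  by (cases A rule: rev_cases) (auto simp: filled_def observable_def)

lemma filled_eq:
  assumes "act_eq m (A @ z @ zs e) (A' @ z' @ zs e')" "filled z" "filled z'" "even e = even e'"
    "observable m A" "observable m A'" "ones A = ones A'"
  shows "length z = length z' \<and> e = e' \<and> A = A'"
proof (intro conjI)
  have m: "3 \<le> m" using assms(5) observableD by blast
  show len: "length z = length z'" using filled_length_eq assms by blast
  \<comment> \<open>With the prefixes absorbed into the filled parts, the countdown compares total
    lengths, and the zeros left at its end compare \<open>e\<close> with \<open>e'\<close>.\<close>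
  have *: "act_eq m ((A @ z) @ zs e) ((A' @ z') @ zs e')" "filled (A @ z)" "filled (A' @ z')"
    using assms filled_prefix by auto
  have len': "length (A @ z) = length (A' @ z')"
    using filled_length_eq[of m "[]" "[]" "A @ z" e "A' @ z'" e'] * m assms(4) by simp
  then have "length (A @ z) + e = length (A @ z) + e'"
    using filled_to_zeros[OF m *] assms(2,4) *(2)
    by (intro act_eq_zeros[OF m]) (auto simp: filled_def)
  then show "e = e'" by simp
  \<comment> \<open>The last 1 of the prefix, with the zeros in front of it, is moved into the
    filled part; the resulting increase in length reveals this gap.\<close>
  show "A = A'" using assms len
  proof (induction "ones A" arbitrary: A A' z z')
    case 0
    have "A = []" if "ones A = 0" "observable m A" for A
      using that observableD(2)[OF that(2)] by (metis count_notin count_list_0_iff last_in_set)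
    then show ?case using 0 by metis
  next
    case (Suc s)
    have *: "\<exists>D d. A = D @ zs d @ [1] \<and> observable m D \<and> ones D = s"
      if one: "ones A = Suc s" and obs: "observable m A" for A
    proof -
      obtain a where a: "A = a @ [1]"
        using observableD(2)[OF obs] one by (cases A rule: rev_cases) auto
      obtain D d where "a = D @ zs d" "D = [] \<or> last D = 1"
        using split_zeros observableD(1)[OF obs] a by (metis le_sup_iff set_append)
      then show ?thesis using one obs a by (auto simp: observable_def)
    qed
    obtain D d where D: "A = D @ zs d @ [1]" "observable m D" "ones D = s"
      using * Suc.hyps(2) Suc.prems(5) by metis
    obtain D' d' where D': "A' = D' @ zs d' @ [1]" "observable m D'" "ones D' = s"
      using * Suc.hyps(2) Suc.prems(6,7) by metis
    have fill: "filled (zs d @ [1] @ z)" if "filled z" for d z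
      using that by (auto simp: filled_def)
    have a: "act_eq m (D @ (zs d @ [1] @ z) @ zs e) (D' @ (zs d' @ [1] @ z') @ zs e')"
      using Suc.prems(1) D D' by simp
    have "length (zs d @ [1] @ z) = length (zs d' @ [1] @ z')"
      using filled_length_eq[OF D(2) D'(2) _ a] fill Suc.prems D D' by simp
    moreover have "D = D'"
      using Suc.hyps(1)[OF _ a] fill Suc.prems D D' calculation by simp
    ultimately show ?case using D D' Suc.prems by simp
  qed
qed

declare pow_out_append [simp del] pow_trans_append [simp del]

section \<open>Normal forms\<close>

text \<open>The second alternative has \<open>m - 1\<close> symbols 1. Its even gap ensures that
  \<open>x_0\<close> as well as \<open>x_1\<close> meets one of the last two symbols 1 as
  \<open>x_1\<close>.\<close>

definition normal :: "nat \<Rightarrow> nat list \<Rightarrow> bool" where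
  "normal m w \<longleftrightarrow> binary w \<and>
     (ones w + 2 \<le> m \<or> (\<exists>v j c. w = v @ [1] @ zs (2 * j) @ [1] @ zs c \<and> ones v + 3 = m))"

section \<open>Separating normal forms by their action\<close>

lemma zs_if_no_ones:
  assumes "binary w" "ones w = 0"
  shows "w = zs (length w)"
proof -
  have "\<forall>a\<in>set w. a = 0" using assms by (auto simp: count_list_0_iff)
  then show ?thesis by (simp add: replicate_length_same)
qed

text \<open>If there is a 1, one of \<open>x_0\<close>, \<open>x_1\<close> arrives at the last 1 as
  \<open>x_1\<close> and is then raised by every 1 until it saturates; the other cannot exceed it.
  Thus the number of symbols 1 is visible up to the cap.\<close>

lemma max_letter_out_low:
  assumes "3 \<le> m" "binary w"
  shows "max (letter_out m 0 w) (letter_out m 1 w) = min (m - 1) (1 + ones w)"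
proof (cases "ones w")
  case 0
  then obtain c where c: "w = zs c" using zs_if_no_ones[OF assms(2)] by blast
  have "{c mod 2, (1 + c) mod 2} = {0, 1}" by (cases "even c") (auto simp: odd_iff_mod_2_eq_one)
  then have "max (c mod 2) ((1 + c) mod 2) = 1"
    by (auto simp: doubleton_eq_iff)
  then show ?thesis using assms(1) c by simp
next
  case (Suc s)
  then obtain v c where v: "w = v @ [1] @ zs c" "binary v" "ones v = s"
    using split_last_one[OF assms(2)] by blast
  have le: "letter_out m 0 w \<le> min (m - 1) (1 + ones w)"
    "letter_out m 1 w \<le> min (m - 1) (1 + ones w)"
    using letter_out_low_le[OF assms(2), of 0 m] letter_out_less[of 0 m w]
      letter_out_low_le[OF assms(2), of 1 m] letter_out_less[of 1 m w] assms(1) by linarith+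
  have *: "letter_out m x w = min (m - 1) (1 + ones w)" if "x < 2" "odd (x + c)" for x
    using keep_last(1)[OF assms(1) that, of v] letter_out_high[of v 2 m] v assms(1) by simp
  show ?thesis
  proof (cases "even c")
    case True
    then show ?thesis using *[of 1] le by simp
  next
    case False
    then show ?thesis using *[of 0] le by simp
  qed
qed

lemma min_ones_act_eq:
  assumes "3 \<le> m" "binary w" "binary w'" "act_eq m w w'"
  shows "min (m - 1) (1 + ones w) = min (m - 1) (1 + ones w')"
proof -
  have "letter_out m 0 w = letter_out m 0 w'" "letter_out m 1 w = letter_out m 1 w'"
    using act_eqD(1)[OF assms(4)] assms(1) by auto
  then show ?thesis using max_letter_out_low[OF assms(1)] assms by metis
qed

text \<open>The opening move of the reading: a letter arriving as \<open>x_1\<close> keeps the last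
  1 and goes on as \<open>x_2\<close>, so that an arbitrary \<open>y\<close> with this 1 becomes a
  filled part of the same length.\<close>

lemma keep_last_filled:
  assumes "observable m A" "binary y" "x < 2" "odd (x + c)"
  obtains z where "next_word m x (A @ y @ [1] @ zs c) = A @ z @ zs c" "filled z"
    "length z = Suc (length y)"
proof -
  note A = observableD[OF assms(1)]
  obtain y' where y': "next_word m 2 (A @ y) = A @ y'" "length y' = length y" "binary y'"
    "y = [] \<or> last y' = 1"
    using next_word_two_fill[OF A(4,1) assms(2) A(2,3)] by metis
  show ?thesis
  proof (rule that[of "y' @ [1]"])
    show "next_word m x (A @ y @ [1] @ zs c) = A @ (y' @ [1]) @ zs c"
      using keep_last(2)[OF A(4) assms(3,4), of "A @ y"] y'(1) by simp
    show "filled (y' @ [1])"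
      using y' by (cases y' rule: rev_cases) (auto simp: filled_def)
  qed (use y' in simp)
qed

lemma observable_split:
  assumes "binary v" "ones v + 3 \<le> m"
  obtains A b where "v = A @ zs b" "observable m A" "ones A = ones v"
proof -
  obtain A b where A: "v = A @ zs b" "A = [] \<or> last A = 1" using split_zeros[OF assms(1)] by blast
  show ?thesis by (rule that[OF A(1)]) (use A assms in \<open>auto simp: observable_def\<close>)
qed

lemma act_eq_low:
  assumes "binary v" "binary v'" "ones v = ones v'" "ones v + 3 \<le> m"
    and eq: "act_eq m (v @ [1] @ zs c) (v' @ [1] @ zs c')"
  shows "v @ [1] @ zs c = v' @ [1] @ zs c'"
proof -
  obtain A b where A: "v = A @ zs b" "observable m A" "ones A = ones v"
    by (rule observable_split[OF assms(1,4)])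
  obtain A' b' where A': "v' = A' @ zs b'" "observable m A'" "ones A' = ones v'"
    by (rule observable_split[OF assms(2)]) (use assms(3,4) in simp)
  define x where "x = (c + 1) mod 2"
  have x: "x < 2" "odd (x + c)" unfolding x_def by presburger+
  have m: "3 \<le> m" "x < m" using assms(4) x by simp_all
  note eqs = act_eqD[OF eq m(2)]
  \<comment> \<open>With different parities the letter would erase the last 1 of the second word and
    output at most \<open>1 + ones v\<close> instead of \<open>2 + ones v\<close>, which is still
    within the cap.\<close>
  have parity: "even c = even c'"
  proof (rule ccontr)
    assume "even c \<noteq> even c'"
    then have "even (x + c')" using x by auto
    then have "letter_out m x (v' @ [1] @ zs c') = letter_out m 1 v'"
      using erase_last(1)[OF m(1) x(1)] by blast
    moreover have "letter_out m x (v @ [1] @ zs c) = min (m - 1) (2 + ones v)"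
      using keep_last(1)[OF m(1) x] letter_out_high[of v 2 m] assms by simp
    ultimately show False using eqs(1) letter_out_low_le[of v' 1 m] assms by simp
  qed
  then have x': "odd (x + c')" using x by auto
  \<comment> \<open>The gap \<open>b\<close> in front of the last 1 enters the filled part and can
    be read from its length.\<close>
  obtain z where z: "next_word m x (A @ zs b @ [1] @ zs c) = A @ z @ zs c" "filled z"
    "length z = Suc (length (zs b))"
    by (rule keep_last_filled[OF A(2) binary_zs x])
  obtain z' where z': "next_word m x (A' @ zs b' @ [1] @ zs c') = A' @ z' @ zs c'" "filled z'"
    "length z' = Suc (length (zs b'))"
    by (rule keep_last_filled[OF A'(2) binary_zs x(1) x'])
  have "act_eq m (A @ z @ zs c) (A' @ z' @ zs c')"
    using eqs(2) z(1) z'(1) A(1) A'(1) by simp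
  moreover have "ones A = ones A'" using A A' assms(3) by simp
  ultimately have "length z = length z' \<and> c = c' \<and> A = A'"
    using z(2) z'(2) parity A(2) A'(2) by (intro filled_eq)
  then show ?thesis using A(1) A'(1) z(3) z'(3) by simp
qed

text \<open>If the last 1 is erased, the letter crosses the even gap as \<open>x_1\<close> and the
  next 1 is kept. So both letters leave as \<open>x_(m-1)\<close>.\<close>

lemma letter_out_even_gap:
  assumes "binary v" "ones v + 3 = m" "x < 2"
  shows "letter_out m x (v @ [1] @ zs (2 * j) @ [1] @ zs c) = m - 1"
proof -
  let ?y = "v @ [1] @ zs (2 * j)"
  have y: "binary ?y" "ones ?y = Suc (ones v)" using assms(1) by auto
  have m: "3 \<le> m" using assms(2) by simp
  have "letter_out m x (?y @ [1] @ zs c) = m - 1"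
  proof (cases "even (x + c)")
    case True
    have "letter_out m x (?y @ [1] @ zs c) = letter_out m 1 ?y"
      using erase_last(1)[OF m assms(3) True] .
    also have "\<dots> = letter_out m 2 v"
      by (rule keep_last(1)[OF m]) auto
    also have "\<dots> = m - 1"
      using letter_out_high[OF assms(1), of 2 m] m assms(2) by simp
    finally show ?thesis .
  next
    case False
    have "letter_out m x (?y @ [1] @ zs c) = letter_out m 2 ?y"
      using keep_last(1)[OF m assms(3) False] .
    also have "\<dots> = m - 1"
      using letter_out_high[OF y(1), of 2 m] y(2) m assms(2) by simp
    finally show ?thesis .
  qed
  then show ?thesis by simp
qed

lemma not_act_eq_low_high:
  assumes "binary v" "binary v'" "ones v + 3 \<le> m" "ones v' + 3 = m"
  shows "\<not> act_eq m (v @ [1] @ zs c) (v' @ [1] @ zs (2 * j) @ [1] @ zs c')"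
proof
  assume eq: "act_eq m (v @ [1] @ zs c) (v' @ [1] @ zs (2 * j) @ [1] @ zs c')"
  define x where "x = c mod 2"
  have x: "x < 2" "even (x + c)" unfolding x_def by presburger+
  have m: "3 \<le> m" "x < m" using assms(3) x by simp_all
  have "letter_out m x (v @ [1] @ zs c) \<le> 1 + ones v"
    using erase_last(1)[OF m(1) x] letter_out_low_le[of v 1 m] assms by simp
  moreover have "letter_out m x (v' @ [1] @ zs (2 * j) @ [1] @ zs c') = m - 1"
    using letter_out_even_gap[OF assms(2,4) x(1)] .
  ultimately show False using act_eqD(1)[OF eq m(2)] assms(3) by simp
qed

text \<open>The erased 1 merges the even gap with the trailing zeros, and only \<open>b\<close>
  enters the filled part. Compared with keeping the last 1, where \<open>b + 2 * j\<close> enters,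
  this separates \<open>b\<close> from \<open>j\<close>.\<close>

lemma erase_last_filled:
  assumes "observable m A" "x < 2" "even (x + c)"
  obtains z where "next_word m x (A @ zs b @ [1] @ zs (2 * j) @ [1] @ zs c) = A @ z @ zs (2 * j + 1 + c)"
    "filled z" "length z = Suc b"
proof -
  obtain z where z: "next_word m 1 (A @ zs b @ [1] @ zs (2 * j)) = A @ z @ zs (2 * j)"
    "filled z" "length z = Suc (length (zs b))"
    by (rule keep_last_filled[OF assms(1) binary_zs, of 1 "2 * j"]) auto
  have "next_word m x ((A @ zs b @ [1] @ zs (2 * j)) @ [1] @ zs c) = A @ z @ zs (2 * j) @ zs (Suc c)"
    using erase_last(2)[OF observableD(4)[OF assms(1)] assms(2,3), of "A @ zs b @ [1] @ zs (2 * j)"]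
      z(1) by simp
  also have "zs (2 * j) @ zs (Suc c) = zs (2 * j + 1 + c)"
    unfolding replicate_add[symmetric] by (simp add: One_nat_def)
  finally show ?thesis using that z by simp
qed

lemma act_eq_high:
  assumes "binary v" "binary v'" "ones v + 3 = m" "ones v' + 3 = m"
    and eq: "act_eq m (v @ [1] @ zs (2 * j) @ [1] @ zs c) (v' @ [1] @ zs (2 * j') @ [1] @ zs c')"
  shows "v @ [1] @ zs (2 * j) @ [1] @ zs c = v' @ [1] @ zs (2 * j') @ [1] @ zs c'"
proof -
  obtain A b where A: "v = A @ zs b" "observable m A" "ones A = ones v"
    by (rule observable_split[OF assms(1) eq_imp_le[OF assms(3)]])
  obtain A' b' where A': "v' = A' @ zs b'" "observable m A'" "ones A' = ones v'"
    by (rule observable_split[OF assms(2) eq_imp_le[OF assms(4)]])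
  have AA': "ones A = ones A'" using A(3) A'(3) assms(3,4) by simp
  have m: "3 \<le> m" using assms by simp
  \<comment> \<open>In the first word, \<open>x\<close> arrives at the last 1 as \<open>x_1\<close>
    and keeps it, whereas \<open>y\<close> arrives as \<open>x_0\<close> and erases it.\<close>
  define x where "x = (c + 1) mod 2"
  define y where "y = c mod 2"
  have x: "x < 2" "odd (x + c)" "x < m" and y: "y < 2" "even (y + c)" "y < m"
    unfolding x_def y_def using m by presburger+
  let ?w = "A @ zs b @ [1] @ zs (2 * j) @ [1] @ zs c"
  let ?w' = "A' @ zs b' @ [1] @ zs (2 * j') @ [1] @ zs c'"
  have eq: "act_eq m ?w ?w'" using eq A(1) A'(1) by simp
  have gap: "binary (zs b @ [1] @ zs (2 * j))" for b j by auto
  have gap_length: "Suc (length (zs b @ [1] @ zs (2 * j))) = b + 2 * j + 2" for b j by simp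
  obtain k where k: "next_word m x ?w = A @ k @ zs c" "filled k" "length k = b + 2 * j + 2"
    using keep_last_filled[OF A(2) gap[of b j] x(1,2)] unfolding append_assoc
      by (metis gap_length)
  obtain e where e: "next_word m y ?w = A @ e @ zs (2 * j + 1 + c)" "filled e" "length e = Suc b"
    using erase_last_filled[OF A(2) y(1,2)] by blast
  show ?thesis
  proof (cases "even c = even c'")
    case True
    then have x': "odd (x + c')" and y': "even (y + c')" using x y by auto
    obtain k' where k': "next_word m x ?w' = A' @ k' @ zs c'" "filled k'" "length k' = b' + 2 * j' + 2"
      using keep_last_filled[OF A'(2) gap[of b' j'] x(1) x'] unfolding append_assoc
      by (metis gap_length)
    obtain e' where e': "next_word m y ?w' = A' @ e' @ zs (2 * j' + 1 + c')" "filled e'"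
      "length e' = Suc b'"
      using erase_last_filled[OF A'(2) y(1) y'] by blast
    have "length k = length k' \<and> c = c' \<and> A = A'"
      using act_eqD(2)[OF eq x(3)] True unfolding k(1) k'(1)
      by (intro filled_eq[OF _ k(2) k'(2) _ A(2) A'(2) AA'])
    moreover have "length e = length e' \<and> 2 * j + 1 + c = 2 * j' + 1 + c' \<and> A = A'"
      using act_eqD(2)[OF eq y(3)] True unfolding e(1) e'(1)
      by (intro filled_eq[OF _ e(2) e'(2) _ A(2) A'(2) AA']) auto
    ultimately show ?thesis using A(1) A'(1) e(3) e'(3) by simp
  next
    \<comment> \<open>Each letter now keeps the last 1 of one word and erases that of the other,
      which yields both \<open>c > c'\<close> and \<open>c' > c\<close>.\<close>
    case False
    then have x': "even (x + c')" and y': "odd (y + c')" using x y by auto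
    obtain k' where k': "next_word m y ?w' = A' @ k' @ zs c'" "filled k'"
      using keep_last_filled[OF A'(2) gap[of b' j'] y(1) y'] unfolding append_assoc
      by (metis gap_length)
    obtain e' where e': "next_word m x ?w' = A' @ e' @ zs (2 * j' + 1 + c')" "filled e'"
      using erase_last_filled[OF A'(2) x(1) x'] by blast
    have "length k = length e' \<and> c = 2 * j' + 1 + c' \<and> A = A'"
      using act_eqD(2)[OF eq x(3)] False unfolding k(1) e'(1)
      by (intro filled_eq[OF _ k(2) e'(2) _ A(2) A'(2) AA']) auto
    moreover have "length e = length k' \<and> 2 * j + 1 + c = c' \<and> A = A'"
      using act_eqD(2)[OF eq y(3)] False unfolding e(1) k'(1)
      by (intro filled_eq[OF _ e(2) k'(2) _ A(2) A'(2) AA']) auto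
    ultimately show ?thesis by simp
  qed
qed

lemma act_eq_sym: "act_eq m v w \<Longrightarrow> act_eq m w v"
  by (simp add: act_eq_def)

lemma normal_cases:
  assumes "normal m w" "3 \<le> m"
  obtains n where "w = zs n"
  | v c where "w = v @ [1] @ zs c" "binary v" "ones v + 3 \<le> m"
  | v j c where "w = v @ [1] @ zs (2 * j) @ [1] @ zs c" "binary v" "ones v + 3 = m"
proof -
  have bin: "binary w" using assms(1) by (simp add: normal_def)
  consider "ones w + 2 \<le> m" | v j c where "w = v @ [1] @ zs (2 * j) @ [1] @ zs c" "ones v + 3 = m"
    using assms(1) by (auto simp: normal_def)
  then show thesis
  proof cases
    case 1
    show ?thesis
    proof (cases "ones w")
      case 0
      then obtain n where "w = zs n" using zs_if_no_ones[OF bin] by blast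
      then show ?thesis using that by blast
    next
      case (Suc s)
      then obtain v c where "w = v @ [1] @ zs c" "binary v" "ones v = s"
        using split_last_one[OF bin] by metis
      then show ?thesis using that(2) Suc 1 by simp
    qed
  next
    case 2
    then show ?thesis using that(3) bin by auto
  qed
qed

text \<open>The larger output of \<open>x_0\<close> and \<open>x_1\<close> gives the number of
  symbols 1, except that \<open>m - 2\<close> and \<open>m - 1\<close> both saturate. The letter
  erasing the last 1 of the word with \<open>m - 2\<close> of them decides that case.\<close>

theorem normal_act_eq:
  assumes "3 \<le> m" "normal m w" "normal m w'" "w \<noteq> []" "w' \<noteq> []" "act_eq m w w'"
  shows "w = w'"
proof -
  have bin: "binary w" "binary w'" using assms by (simp_all add: normal_def)
  have cap: "min (m - 1) (1 + ones w) = min (m - 1) (1 + ones w')"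
    using min_ones_act_eq assms bin by blast
  show ?thesis
  proof (cases rule: normal_cases[OF assms(2,1)])
    case (1 n)
    have "ones w' = 0" using cap assms(1) 1 by (simp add: min_def split: if_splits)
    then obtain n' where "w' = zs n'" using zs_if_no_ones[OF bin(2)] by blast
    then show ?thesis using act_eq_zeros[of m n n'] 1 assms by simp
  next
    case low: (2 v c)
    show ?thesis
    proof (cases rule: normal_cases[OF assms(3,1)])
      case (1 n)
      then show ?thesis using cap low assms(1) by (simp add: min_def split: if_splits)
    next
      case (2 v' c')
      have "ones v = ones v'" using cap low 2 by (simp add: min_def split: if_splits)
      then show ?thesis using act_eq_low[of v v' m c c'] low 2 assms by simp
    next
      case (3 v' j c')
      then show ?thesis using not_act_eq_low_high[of v v' m c j c'] low assms by simp
    qed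
  next
    case high: (3 v j c)
    show ?thesis
    proof (cases rule: normal_cases[OF assms(3,1)])
      case (1 n)
      then show ?thesis using cap high assms(1) by (simp add: min_def split: if_splits)
    next
      case (2 v' c')
      then show ?thesis
        using not_act_eq_low_high[of v' v m c' j c] high assms act_eq_sym[OF assms(6)] by simp
    next
      case (3 v' j' c')
      then show ?thesis using act_eq_high[of v v' m j c j' c'] high assms by simp
    qed
  qed
qed

section \<open>The relations and reduction to normal form\<close>

declare generated_congruence.trans [trans]

lemma free_semigroup_binary [simp]: "w \<in> free_semigroup {0, 1} \<longleftrightarrow> binary w \<and> w \<noteq> []"
  by (auto simp: free_semigroup_def)

lemma generated_congruence_context:
  assumes "generated_congruence {0, 1} R u v" "binary a" "binary b"
  shows "generated_congruence {0, 1} R (a @ u @ b) (a @ v @ b)"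
proof -
  have "generated_congruence {0, 1} R (u @ b) (v @ b)"
    using generated_congruence.mult[OF assms(1) generated_congruence.refl, of b] assms
    by (cases "b = []") auto
  then show ?thesis
    using generated_congruence.mult[OF generated_congruence.refl, of a "{0, 1}" R "u @ b" "v @ b"]
      assms by (cases "a = []") auto
qed

definition rels3 :: "(nat list \<times> nat list) set" where
  "rels3 = {([1,1,1], [0,1,1]), ([1,0,1], [0,0,1])}"

text \<open>The general form covers \<open>m = 4\<close> too, where \<open>prod_word p 0\<close> is
  empty. The exponents are given by a whole function \<open>p\<close>, of which only finitely many
  values matter.\<close>

definition rels :: "nat \<Rightarrow> (nat list \<times> nat list) set" where
  "rels m = (if m = 3 then rels3 else
     {(prod_word p (m - 4) @ [1,1,1,1], prod_word p (m - 4) @ [1,0,1,1]) | p. True} \<union>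
     {(prod_word p (m - 3) @ [1,0,1], prod_word p (m - 3) @ [0,0,1]) | p. True})"

abbreviation cong :: "nat \<Rightarrow> nat list \<Rightarrow> nat list \<Rightarrow> bool" where
  "cong m \<equiv> generated_congruence {0, 1} (rels m)"

abbreviation cong3 :: "nat list \<Rightarrow> nat list \<Rightarrow> bool" (infix "\<approx>" 50) where
  "u \<approx> v \<equiv> generated_congruence {0, 1} rels3 u v"

section \<open>Calculus with the two relations of the case \<open>m = 3\<close>\<close>

lemma rels3_context:
  assumes "binary a" "binary b"
  shows "a @ [1,1,1] @ b \<approx> a @ [0,1,1] @ b" "a @ [1,0,1] @ b \<approx> a @ [0,0,1] @ b"
  using assms
  by (intro generated_congruence_context generated_congruence.rel; simp add: rels3_def)+

lemma zs_add2: "zs (n + 2) = zs n @ [0, 0]"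
proof -
  have "zs 2 = [0, 0]" by (simp add: numeral_2_eq_2)
  then show ?thesis unfolding replicate_add by simp
qed

text \<open>Read backwards, the second relation puts a 1 into a gap. It splits an odd gap into a
  shorter odd one, treated by induction, and a gap of length 1.\<close>

lemma odd_gap: "[1] @ zs (2 * i + 1) @ [1] \<approx> zs (2 * i + 2) @ [1]"
proof (induction i)
  case 0
  show ?case using rels3_context(2)[of "[]" "[]"] by (simp add: numeral_2_eq_2 One_nat_def)
next
  case (Suc i)
  have "[1] @ zs (2 * Suc i + 1) @ [1] = ([1] @ zs (2 * i + 1)) @ [0,0,1] @ []"
    using zs_add2[of "2 * i + 1"] by simp
  also have "\<dots> \<approx> ([1] @ zs (2 * i + 1)) @ [1,0,1] @ []"
    by (rule generated_congruence.sym[OF rels3_context(2)]) auto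
  also have "\<dots> = [] @ ([1] @ zs (2 * i + 1) @ [1]) @ [0, 1]" by simp
  also have "\<dots> \<approx> [] @ (zs (2 * i + 2) @ [1]) @ [0, 1]"
    by (rule generated_congruence_context[OF Suc]) auto
  also have "\<dots> = zs (2 * i + 2) @ [1,0,1] @ []" by simp
  also have "\<dots> \<approx> zs (2 * i + 2) @ [0,0,1] @ []"
    by (rule rels3_context(2)) auto
  also have "\<dots> = zs (2 * Suc i + 2) @ [1]"
    using zs_add2[of "2 * i + 2"] by simp
  finally show ?case .
qed

lemma one_before_adjacent_gap: "[1,1] @ zs (2 * j) @ [1] \<approx> [0,1] @ zs (2 * j) @ [1]"
proof (induction j)
  case 0
  show ?case using rels3_context(1)[of "[]" "[]"] by simp
next
  case (Suc j)
  have z: "a @ zs (2 * Suc j) @ [1] = (a @ zs (2 * j)) @ [0,0,1] @ []" for a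
    using zs_add2[of "2 * j"] by simp
  have "[1,1] @ zs (2 * Suc j) @ [1] \<approx> ([1,1] @ zs (2 * j)) @ [1,0,1] @ []"
    unfolding z by (rule generated_congruence.sym[OF rels3_context(2)]) auto
  also have "\<dots> = [] @ ([1,1] @ zs (2 * j) @ [1]) @ [0,1]" by simp
  also have "\<dots> \<approx> [] @ ([0,1] @ zs (2 * j) @ [1]) @ [0,1]"
    by (rule generated_congruence_context[OF Suc]) auto
  also have "\<dots> = ([0,1] @ zs (2 * j)) @ [1,0,1] @ []" by simp
  also have "\<dots> \<approx> [0,1] @ zs (2 * Suc j) @ [1]"
    unfolding z by (rule rels3_context(2)) auto
  finally show ?case .
qed

text \<open>A 1 inserted into the first gap shortens it by two, and the \<open>0 1\<close> behind it
  becomes \<open>1 1\<close> by the adjacent case. After the induction hypothesis both changes are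
  undone.\<close>

lemma one_before_even_gaps:
  "[1] @ zs (2 * i) @ [1] @ zs (2 * j) @ [1] \<approx> [0] @ zs (2 * i) @ [1] @ zs (2 * j) @ [1]"
proof (induction i arbitrary: j)
  case 0
  then show ?case using one_before_adjacent_gap[of j] by simp
next
  case (Suc i)
  let ?t = "zs (2 * j) @ [1]"
  have z: "a @ zs (2 * Suc i) @ [1] @ ?t = (a @ zs (2 * i)) @ [0,0,1] @ ?t" for a
    using zs_add2[of "2 * i"] by simp
  have t: "[0,1] @ ?t \<approx> [1,1] @ ?t"
    by (rule generated_congruence.sym[OF one_before_adjacent_gap])
  have "[1] @ zs (2 * Suc i) @ [1] @ ?t \<approx> ([1] @ zs (2 * i)) @ [1,0,1] @ ?t"
    unfolding z by (rule generated_congruence.sym[OF rels3_context(2)]) auto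
  also have "\<dots> = ([1] @ zs (2 * i) @ [1]) @ ([0,1] @ ?t) @ []" by simp
  also have "\<dots> \<approx> ([1] @ zs (2 * i) @ [1]) @ ([1,1] @ ?t) @ []"
    by (rule generated_congruence_context[OF t]) auto
  also have "\<dots> = [] @ ([1] @ zs (2 * i) @ [1] @ zs (2 * 0) @ [1]) @ [1] @ ?t" by simp
  \<comment> \<open>The hypothesis is applied to a last gap of length 0, which is why
    \<open>j\<close> is arbitrary.\<close>
  also have "\<dots> \<approx> [] @ ([0] @ zs (2 * i) @ [1] @ zs (2 * 0) @ [1]) @ [1] @ ?t"
    by (rule generated_congruence_context[OF Suc]) auto
  also have "\<dots> = ([0] @ zs (2 * i) @ [1]) @ ([1,1] @ ?t) @ []" by simp
  also have "\<dots> \<approx> ([0] @ zs (2 * i) @ [1]) @ ([0,1] @ ?t) @ []"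
    by (rule generated_congruence_context[OF generated_congruence.sym[OF t]]) auto
  also have "\<dots> = ([0] @ zs (2 * i)) @ [1,0,1] @ ?t" by simp
  also have "\<dots> \<approx> [0] @ zs (2 * Suc i) @ [1] @ ?t"
    unfolding z by (rule rels3_context(2)) auto
  finally show ?case .
qed

lemma one_before_gaps:
  "[1] @ zs b @ [1] @ zs (2 * j) @ [1] \<approx> [0] @ zs b @ [1] @ zs (2 * j) @ [1]"
proof (cases "even b")
  case True
  then show ?thesis using one_before_even_gaps by (auto elim: evenE)
next
  case False
  then obtain i where i: "b = 2 * i + 1" by (auto elim: oddE)
  have "[] @ ([1] @ zs (2 * i + 1) @ [1]) @ zs (2 * j) @ [1]
      \<approx> [] @ (zs (2 * i + 2) @ [1]) @ zs (2 * j) @ [1]"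
    by (rule generated_congruence_context[OF odd_gap]) auto
  then show ?thesis using i by (simp add: One_nat_def)
qed

text \<open>Symbols are added on the left. A new 1 turns into 0 in front of a single 1 at an odd
  gap, or in front of two symbols 1 at an even gap; otherwise it may stay.\<close>

lemma tail_normal_form:
  assumes "w \<noteq> []" "binary w"
  shows "\<exists>v. w \<approx> v \<and> length v = length w \<and> binary v \<and>
    (ones v \<le> 1 \<or> (\<exists>b j c. v = zs b @ [1] @ zs (2 * j) @ [1] @ zs c))"
  using assms
proof (induction w rule: list_nonempty_induct)
  case (single a)
  then show ?case by (intro exI[of _ "[a]"]) (auto intro: generated_congruence.refl)
next
  case (cons a w)
  then obtain v where v: "w \<approx> v" "length v = length w" "binary v"
    and nf: "ones v \<le> 1 \<or> (\<exists>b j c. v = zs b @ [1] @ zs (2 * j) @ [1] @ zs c)" by auto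
  have a: "a = 0 \<or> a = 1" using cons.prems by auto
  have av: "a # w \<approx> a # v"
    using generated_congruence_context[OF v(1), of "[a]" "[]"] a by auto
  have bin: "binary (a # v)" using a v(3) by auto
  have len: "length (a # v) = length (a # w)" using v(2) by simp
  show ?case
  proof (cases "a = 0")
    case True
    have "ones (a # v) \<le> 1 \<or> (\<exists>b j c. a # v = zs b @ [1] @ zs (2 * j) @ [1] @ zs c)"
      using nf
    proof
      assume "\<exists>b j c. v = zs b @ [1] @ zs (2 * j) @ [1] @ zs c"
      then obtain b j c where "v = zs b @ [1] @ zs (2 * j) @ [1] @ zs c" by blast
      then have "a # v = zs (Suc b) @ [1] @ zs (2 * j) @ [1] @ zs c" using True by simp
      then show ?thesis by blast
    qed (use True in simp)
    then show ?thesis using av bin v(2) by (intro exI[of _ "a # v"]) simp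
  next
    case False
    then have a1: "a = 1" using a by simp
    consider "ones v = 0" | "ones v = Suc 0"
      | b j c where "v = zs b @ [1] @ zs (2 * j) @ [1] @ zs c" using nf by fastforce
    then show ?thesis
    proof cases
      case 1
      then show ?thesis using av bin v(2) a1 by (intro exI[of _ "a # v"]) simp
    next
      case 2
      then obtain u c where u: "v = u @ [1] @ zs c" "binary u" "ones u = 0"
        by (rule split_last_one[OF v(3)])
      obtain b where b: "v = zs b @ [1] @ zs c" using u(1) zs_if_no_ones[OF u(2,3)] by metis
      show ?thesis
      proof (cases "even b")
        case True
        then obtain j where "b = 2 * j" by (auto elim: evenE)
        then have "a # v = zs 0 @ [1] @ zs (2 * j) @ [1] @ zs c" using a1 b by simp
        then show ?thesis using av bin len by blast
      next
        case False
        then obtain i where i: "b = 2 * i + 1" by (auto elim: oddE)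
        let ?v = "(zs (2 * i + 2) @ [1]) @ zs c"
        have "[] @ ([1] @ zs (2 * i + 1) @ [1]) @ zs c \<approx> [] @ ?v"
          by (rule generated_congruence_context[OF odd_gap]) auto
        then have "a # v \<approx> ?v" using a1 b i by simp
        with av have "a # w \<approx> ?v" by (rule generated_congruence.trans)
        then show ?thesis using v(2) b i by (intro exI[of _ ?v]) auto
      qed
    next
      case 3
      let ?v = "zs (Suc b) @ [1] @ zs (2 * j) @ [1] @ zs c"
      have "[] @ ([1] @ zs b @ [1] @ zs (2 * j) @ [1]) @ zs c
          \<approx> [] @ ([0] @ zs b @ [1] @ zs (2 * j) @ [1]) @ zs c"
        by (rule generated_congruence_context[OF one_before_gaps]) auto
      then have "a # v \<approx> ?v" using a1 3 by simp
      with av have "a # w \<approx> ?v" by (rule generated_congruence.trans)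
      moreover have "length ?v = length (a # w)" "binary ?v" using v(2) 3 by auto
      ultimately show ?thesis by blast
    qed
  qed
qed

section \<open>Lifting the calculus behind \<open>m - 3\<close> symbols 1\<close>

lemma prod_word_0 [simp]: "prod_word p 0 = []"
  by (simp add: prod_word_def)

lemma prod_word_Suc: "prod_word p (Suc r) = prod_word p r @ [1] @ zs (p (Suc r))"
  by (simp add: prod_word_def One_nat_def)

lemma binary_prod_word [simp]: "binary (prod_word p r)"
  by (induction r) (auto simp: prod_word_Suc)

lemma ones_prod_word [simp]: "ones (prod_word p r) = r"
  by (induction r) (auto simp: prod_word_Suc)

lemma prod_word_cong: "(\<And>i. i \<le> r \<Longrightarrow> p i = q i) \<Longrightarrow> prod_word p r = prod_word q r"
  by (induction r) (auto simp: prod_word_Suc)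

text \<open>The exponents are the gaps of \<open>u\<close>; this makes the families of relations
  applicable behind every word with enough symbols 1.\<close>

lemma prod_word_suffix:
  "\<lbrakk>binary u; r \<le> ones u\<rbrakk> \<Longrightarrow> \<exists>a p. binary a \<and> u = a @ prod_word p r"
proof (induction r arbitrary: u)
  case (Suc r)
  then obtain s where s: "ones u = Suc s" "r \<le> s" by (metis Suc_le_D Suc_le_mono)
  then obtain v c where v: "u = v @ [1] @ zs c" "binary v" "ones v = s"
    using split_last_one Suc.prems by blast
  then obtain a p where p: "binary a" "v = a @ prod_word p r" using Suc.IH s by blast
  have "prod_word (p(Suc r := c)) r = prod_word p r" by (rule prod_word_cong) simp
  then have "u = a @ prod_word (p(Suc r := c)) (Suc r)"
    using v(1) p by (simp add: prod_word_Suc)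
  then show ?case using p by blast
qed auto

lemma cong_odd_gap:
  assumes "4 \<le> m" "binary u" "m \<le> ones u + 3" "binary b"
  shows "cong m (u @ [1,0,1] @ b) (u @ [0,0,1] @ b)"
proof -
  obtain a p where a: "binary a" "u = a @ prod_word p (m - 3)"
    using prod_word_suffix[OF assms(2), of "m - 3"] assms(3) by (meson le_diff_conv)
  have "cong m (prod_word p (m - 3) @ [1,0,1]) (prod_word p (m - 3) @ [0,0,1])"
    using assms(1) by (intro generated_congruence.rel) (auto simp: rels_def)
  then show ?thesis
    using generated_congruence_context[OF _ a(1) assms(4)] a(2) by fastforce
qed

lemma cong_ones_tight:
  assumes "4 \<le> m" "binary u" "m \<le> ones u + 4" "binary b"
  shows "cong m (u @ [1,1,1,1] @ b) (u @ [1,0,1,1] @ b)"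
proof -
  obtain a p where a: "binary a" "u = a @ prod_word p (m - 4)"
    using prod_word_suffix[OF assms(2), of "m - 4"] assms(3) by (meson le_diff_conv)
  have "cong m (prod_word p (m - 4) @ [1,1,1,1]) (prod_word p (m - 4) @ [1,0,1,1])"
    using assms(1) by (intro generated_congruence.rel) (auto simp: rels_def)
  then show ?thesis
    using generated_congruence_context[OF _ a(1) assms(4)] a(2) by fastforce
qed

text \<open>Both sides reduce from \<open>1 1 1 1 1\<close>, where the relation for four symbols 1
  applies at two overlapping positions.\<close>

lemma cong_ones_zero:
  assumes "4 \<le> m" "binary u" "m \<le> ones u + 4" "binary b"
  shows "cong m (u @ [1,0,1,1,1] @ b) (u @ [1,0,0,1,1] @ b)"
proof -
  have "cong m (u @ [1,0,1,1] @ ([1] @ b)) (u @ [1,1,1,1] @ ([1] @ b))"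
    by (rule generated_congruence.sym[OF cong_ones_tight]) (use assms in auto)
  also have "u @ [1,1,1,1] @ ([1] @ b) = (u @ [1]) @ [1,1,1,1] @ b" by simp
  also have "cong m \<dots> ((u @ [1]) @ [1,0,1,1] @ b)"
    by (rule cong_ones_tight) (use assms in auto)
  also have "\<dots> = (u @ [1]) @ [1,0,1] @ ([1] @ b)" by simp
  also have "cong m \<dots> ((u @ [1]) @ [0,0,1] @ ([1] @ b))"
    by (rule cong_odd_gap) (use assms in auto)
  finally show ?thesis by simp
qed

text \<open>The presentation provides \<open>1 1 1 = 0 1 1\<close> only directly behind another 1.
  Once it holds behind an arbitrary gap, the whole calculus of the case \<open>m = 3\<close> is
  available behind \<open>m - 3\<close> symbols 1.\<close>

lemma cong_ones_zs:
  assumes "4 \<le> m" "binary u" "m \<le> ones u + 4" "binary b"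
  shows "cong m (u @ [1] @ zs p @ [1,1,1] @ b) (u @ [1] @ zs p @ [0,1,1] @ b)"
  using assms(4)
proof (induction p arbitrary: b rule: induct_nat_012)
  case 0
  show ?case using cong_ones_tight[OF assms(1-3) 0] by simp
next
  case 1
  show ?case using cong_ones_zero[OF assms(1-3) 1] by simp
next
  case (ge2 q)
  let ?U = "u @ [1] @ zs q"
  have U: "binary ?U" "m \<le> ones ?U + 3" using assms by auto
  have z: "zs (Suc (Suc q)) = zs q @ [0,0]" using zs_add2[of q] by simp
  have "cong m (?U @ [0,0,1] @ [1,1] @ b) (?U @ [1,0,1] @ [1,1] @ b)"
    by (rule generated_congruence.sym[OF cong_odd_gap]) (use assms U ge2 in auto)
  also have "?U @ [1,0,1] @ [1,1] @ b = ?U @ [1,0,1,1,1] @ b" by simp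
  also have "cong m \<dots> (?U @ [1,0,0,1,1] @ b)"
    by (rule cong_ones_zero) (use assms U ge2 in auto)
  also have "\<dots> = (?U @ [1]) @ [0,0,1] @ [1] @ b" by simp
  also have "cong m \<dots> ((?U @ [1]) @ [1,0,1] @ [1] @ b)"
    by (rule generated_congruence.sym[OF cong_odd_gap]) (use assms U ge2 in auto)
  also have "\<dots> = (?U @ [1]) @ [1,0,1,1] @ b" by simp
  also have "cong m \<dots> ((?U @ [1]) @ [1,1,1,1] @ b)"
    by (rule generated_congruence.sym[OF cong_ones_tight]) (use assms U ge2 in auto)
  also have "\<dots> = u @ [1] @ zs q @ [1,1,1] @ [1,1] @ b" by simp
  also have "cong m \<dots> (u @ [1] @ zs q @ [0,1,1] @ [1,1] @ b)"
    by (rule ge2.IH) (use ge2 in auto)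
  also have "\<dots> = (?U @ [0]) @ [1,1,1,1] @ b" by simp
  also have "cong m \<dots> ((?U @ [0]) @ [1,0,1,1] @ b)"
    by (rule cong_ones_tight) (use assms U ge2 in auto)
  also have "\<dots> = (?U @ [0]) @ [1,0,1] @ [1] @ b" by simp
  also have "cong m \<dots> ((?U @ [0]) @ [0,0,1] @ [1] @ b)"
    by (rule cong_odd_gap) (use assms U ge2 in auto)
  finally show ?case using z by simp
qed

lemma cong_rels3:
  assumes "3 \<le> m" "(x, y) \<in> rels3" "binary u" "m \<le> ones u + 3"
  shows "cong m (u @ x) (u @ y)"
proof (cases "m = 3")
  case True
  then have "cong m x y" using assms(2) by (intro generated_congruence.rel) (simp add: rels_def)
  then show ?thesis using generated_congruence_context[of "rels m" x y u "[]"] assms(3) by simp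
next
  case False
  then have m: "4 \<le> m" using assms(1) by simp
  obtain s where s: "ones u = Suc s" using m assms(4) by (cases "ones u") auto
  then obtain v c where v: "u = v @ [1] @ zs c" "binary v" "ones v = s"
    by (rule split_last_one[OF assms(3)])
  have "m \<le> ones v + 4" using v(3) s assms(4) by simp
  note ones = cong_ones_zs[OF m v(2) this, of "[]" c]
  consider "x = [1,1,1]" "y = [0,1,1]" | "x = [1,0,1]" "y = [0,0,1]"
    using assms(2) by (auto simp: rels3_def)
  then show ?thesis
  proof cases
    case 1
    then show ?thesis using ones v(1) by simp
  next
    case 2
    then show ?thesis using cong_odd_gap[OF m assms(3,4), of "[]"] by simp
  qed
qed

text \<open>The prefix is arbitrary because in a product the second factor is rewritten behind
  \<open>u @ y\<close>, which has at least as many symbols 1.\<close>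

lemma cong_tail:
  assumes "3 \<le> m"
  shows "x \<approx> y \<Longrightarrow> binary u \<Longrightarrow> m \<le> ones u + 3 \<Longrightarrow>
    cong m (u @ x) (u @ y) \<and> binary x \<and> binary y"
proof (induction arbitrary: u rule: generated_congruence.induct)
  case (rel x y)
  then show ?case using cong_rels3[OF assms] by (auto simp: rels3_def)
next
  case (refl x)
  then show ?case by (auto intro!: generated_congruence.refl)
next
  case (sym x y)
  then show ?case by (blast intro: generated_congruence.sym)
next
  case (trans x y z)
  then show ?case by (blast intro: generated_congruence.trans)
next
  case (mult x y x' y')
  have "cong m ([] @ (u @ x) @ x') ([] @ (u @ y) @ x')"
    using mult by (intro generated_congruence_context) auto
  moreover have "cong m ((u @ y) @ x') ((u @ y) @ y')"
    using mult by (intro mult.IH(2)[THEN conjunct1]) auto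
  ultimately have "cong m ((u @ x) @ x') ((u @ y) @ y')"
    using generated_congruence.trans by (metis append_Nil append_assoc)
  then show ?case using mult by auto
qed

lemma split_at_ones: "r \<le> ones w \<Longrightarrow> \<exists>u t. w = u @ t \<and> ones u = r"
proof (induction w rule: rev_induct)
  case (snoc a w)
  show ?case
  proof (cases "r \<le> ones w")
    case True
    then obtain u t where "w = u @ t" "ones u = r" using snoc.IH by blast
    then have "w @ [a] = u @ (t @ [a]) \<and> ones u = r" by simp
    then show ?thesis by blast
  next
    case False
    then have "w @ [a] = (w @ [a]) @ [] \<and> ones (w @ [a]) = r" using snoc.prems
      by (auto split: if_splits)
    then show ?thesis by blast
  qed
qed simp

theorem normal_form_exists:
  assumes "3 \<le> m" "binary w" "w \<noteq> []"
  shows "\<exists>v. cong m w v \<and> normal m v \<and> length v = length w"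
proof (cases "ones w + 2 \<le> m")
  case True
  then show ?thesis using assms
    by (intro exI[of _ w]) (auto simp: normal_def intro: generated_congruence.refl)
next
  case False
  then have "m - 3 \<le> ones w" by simp
  then obtain u t where t: "w = u @ t" "ones u = m - 3" using split_at_ones by blast
  then have bin: "binary u" "binary t" "t \<noteq> []" using assms False by auto
  obtain v where v: "t \<approx> v" "length v = length t" "binary v"
    "ones v \<le> 1 \<or> (\<exists>b j c. v = zs b @ [1] @ zs (2 * j) @ [1] @ zs c)"
    using tail_normal_form[OF bin(3,2)] by blast
  have "cong m (u @ t) (u @ v)" using cong_tail[OF assms(1) v(1) bin(1)] t by simp
  moreover have "normal m (u @ v)"
    using v(4)
  proof
    assume "ones v \<le> 1"
    then have "ones (u @ v) + 2 \<le> m" using t(2) assms(1) by simp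
    then show ?thesis using bin(1) v(3) by (simp add: normal_def)
  next
    assume "\<exists>b j c. v = zs b @ [1] @ zs (2 * j) @ [1] @ zs c"
    then obtain b j c where "u @ v = (u @ zs b) @ [1] @ zs (2 * j) @ [1] @ zs c" by auto
    moreover have "ones (u @ zs b) + 3 = m" "binary (u @ v)" using t bin v assms by auto
    ultimately show ?thesis unfolding normal_def by blast
  qed
  ultimately show ?thesis using t v(2) by (intro exI[of _ "u @ v"]) simp
qed

section \<open>The relations hold\<close>

text \<open>Needed where \<open>x_2\<close> fills a gap on one side of a relation while
  \<open>x_3\<close> leaves it alone on the other.\<close>

lemma ones_approx_zs: "replicate c 1 @ [1,1,1] \<approx> zs c @ [1,1,1]"
proof (induction c)
  case (Suc c)
  have "replicate (Suc c) 1 @ [1,1,1] = [] @ [1,1,1] @ replicate (Suc c) (1::nat)"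
    by (simp add: replicate_app_Cons_same)
  also have "\<dots> \<approx> [] @ [0,1,1] @ replicate (Suc c) 1"
    by (rule rels3_context(1)) auto
  also have "\<dots> = [0] @ (replicate c 1 @ [1,1,1]) @ []"
    by (simp add: replicate_app_Cons_same)
  also have "\<dots> \<approx> [0] @ (zs c @ [1,1,1]) @ []"
    by (rule generated_congruence_context[OF Suc]) auto
  finally show ?case by simp
qed (auto intro: generated_congruence.refl)

lemma rels_step:
  assumes "3 \<le> m" "(v, w) \<in> rels m" "x < m"
  shows "letter_out m x v = letter_out m x w \<and> cong m (next_word m x v) (next_word m x w)"
proof (cases "m = 3")
  case True
  then have "x = 0 \<or> x = 1 \<or> x = 2" using assms(3) by auto
  moreover have "cong m [1,1,0] [1,1,0]" "cong m [1,1,1] [1,1,1]" "cong m [0,0,0] [0,0,0]"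
    by (auto intro: generated_congruence.refl)
  ultimately show ?thesis
    using assms(2) True by (auto simp: rels_def rels3_def B_out_def B_trans_def)
next
  case False
  then have m: "4 \<le> m" using assms(1) by simp
  consider p where "v = prod_word p (m - 4) @ [1,1,1,1]" "w = prod_word p (m - 4) @ [1,0,1,1]"
    | p where "v = prod_word p (m - 3) @ [1,0,1]" "w = prod_word p (m - 3) @ [0,0,1]"
    using assms(2) False by (auto simp: rels_def)
  then show ?thesis
  proof cases
    case 1
    \<comment> \<open>With \<open>m - 3\<close> symbols 1 and a 1 at its end, this prefix is
      unchanged by all letters from \<open>x_2\<close> on and sends them to \<open>x_(m-1)\<close>.
      The two sides may therefore enter it with different letters.\<close>
    let ?u = "prod_word p (m - 4) @ [1]"
    have u: "next_word m y ?u = ?u" "letter_out m y ?u = m - 1" if "2 \<le> y" "y < m" for y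
    proof -
      show "next_word m y ?u = ?u" using that m by (intro next_word_two_last) auto
      show "letter_out m y ?u = m - 1" using that m letter_out_high[of ?u y m] by simp
    qed
    have rel: "cong m (?u @ [1,1,1]) (?u @ [0,1,1])"
      using False by (intro generated_congruence.rel) (auto simp: rels_def)
    have refl: "cong m (?u @ [1,1,0]) (?u @ [1,1,0])"
      by (rule generated_congruence.refl) simp
    have vw: "v = ?u @ [1,1,1]" "w = ?u @ [0,1,1]" using 1 by simp_all
    have out: "2 \<le> letter_out m x [1,1,1]" "2 \<le> letter_out m x [0,1,1]"
      using m by (auto simp: B_out_def)
    have "next_word m x [1,1,1] = [1,1,0] \<and> next_word m x [0,1,1] = [1,1,0] \<or>
      next_word m x [1,1,1] = [1,1,1] \<and> next_word m x [0,1,1] = [0,1,1]"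
      using m by (auto simp: B_out_def B_trans_def)
    moreover have "letter_out m x (?u @ s) = m - 1"
      "next_word m x (?u @ s) = ?u @ next_word m x s" if "2 \<le> letter_out m x s" for s
      using u[OF that letter_out_less[OF assms(3,1)]]
      unfolding pow_out_append[of _ _ ?u s] pow_trans_append[of _ _ ?u s] by simp_all
    ultimately show ?thesis unfolding vw using out rel refl by metis
  next
    case 2
    let ?u = "prod_word p (m - 3)"
    have "ones ?u = Suc (m - 4)" using m by simp
    then obtain u0 c where u0: "?u = u0 @ [1] @ zs c" "binary u0" "ones u0 = m - 4"
      by (rule split_last_one[OF binary_prod_word])
    have out: "letter_out m y ?u = m - 1" if "2 \<le> y" "y < m" for y
      using that m letter_out_high[of ?u y m] by simp
    have rel: "cong m (?u @ [1,0,1]) (?u @ [0,0,1])"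
      using False by (intro generated_congruence.rel) (auto simp: rels_def)
    have "x = 0 \<or> x = 1 \<or> 2 \<le> x" by auto
    then show ?thesis
    proof (elim disjE)
      assume x: "x = 0"
      then have "letter_out m x [1,0,1] = 1 \<and> letter_out m x [0,0,1] = 1"
        "next_word m x [1,0,1] = [0,0,0] \<and> next_word m x [0,0,1] = [0,0,0]"
        using m by (auto simp: B_out_def B_trans_def)
      moreover have "cong m (next_word m 1 ?u @ [0,0,0]) (next_word m 1 ?u @ [0,0,0])"
        using binary_next_word[OF binary_prod_word] by (intro generated_congruence.refl) simp
      ultimately show ?thesis using 2 by (simp add: pow_out_append pow_trans_append)
    next
      \<comment> \<open>The prefix is entered as \<open>x_3\<close> on one side and as
        \<open>x_2\<close> on the other. Only \<open>x_2\<close> fills the last gap, but the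
        \<open>1 1 1\<close> produced behind it makes both results congruent.\<close>
      assume x: "x = 1"
      then have *: "letter_out m x [1,0,1] = 3 \<and> letter_out m x [0,0,1] = 2"
        "next_word m x [1,0,1] = [1,1,1] \<and> next_word m x [0,0,1] = [1,1,1]"
        using m by (auto simp: B_out_def B_trans_def)
      have "next_word m 2 (u0 @ [1]) = u0 @ [1]"
        using m u0(2) by (intro next_word_two_last) auto
      then have n2: "next_word m 2 ?u = u0 @ [1] @ replicate c 1"
        using pow_trans_append[of "B m" 2 "u0 @ [1]" "zs c"] u0(1) by simp
      have n3: "next_word m 3 ?u = u0 @ [1] @ zs c"
        using next_word_high[of ?u 3 m] m u0(1,2) by simp
      have "cong m ((u0 @ [1]) @ (zs c @ [1,1,1])) ((u0 @ [1]) @ (replicate c 1 @ [1,1,1]))"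
        using cong_tail[OF assms(1) generated_congruence.sym[OF ones_approx_zs[of c]], of "u0 @ [1]"]
          u0 m by simp
      then show ?thesis
        using 2 * out[of 2] out[of 3] m n2 n3 by (simp add: pow_out_append pow_trans_append)
    next
      assume x: "2 \<le> x"
      have *: "3 \<le> letter_out m x [1,0,1]" "3 \<le> letter_out m x [0,0,1]"
        "next_word m x [1,0,1] = [1,0,1]" "next_word m x [0,0,1] = [0,0,1]"
        using m x by (auto simp: B_out_def B_trans_def)
      have less: "letter_out m x [1,0,1] < m" "letter_out m x [0,0,1] < m"
        by (rule letter_out_less[OF assms(3,1)])+
      have n: "next_word m y ?u = ?u" if "3 \<le> y" "y < m" for y
        using next_word_high that by simp
      show ?thesis
        unfolding 2 pow_out_append pow_trans_append
        using n[OF *(1) less(1)] n[OF *(2) less(2)] out[OF _ less(1)] out[OF _ less(2)] * rel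
        by simp
    qed
  qed
qed

lemma cong_step:
  assumes "3 \<le> m"
  shows "cong m v w \<Longrightarrow> x < m \<Longrightarrow>
    letter_out m x v = letter_out m x w \<and> cong m (next_word m x v) (next_word m x w)"
proof (induction arbitrary: x rule: generated_congruence.induct)
  case (rel v w)
  then show ?case using rels_step[OF assms] by blast
next
  case (refl v)
  then have "next_word m x v \<noteq> []" by (metis free_semigroup_binary length_0_conv length_pow_trans)
  then show ?case using refl binary_next_word[of v m x] by (auto intro: generated_congruence.refl)
next
  case (sym v w)
  then show ?case using generated_congruence.sym by metis
next
  case (trans u v w)
  then show ?case using generated_congruence.trans by metis
next
  case (mult u v u' v')
  have "letter_out m x u' < m" using letter_out_less[OF mult.prems assms] .
  then show ?case
    using mult.IH(1)[of "letter_out m x u'"] mult.IH(2)[OF mult.prems]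
    by (auto simp: pow_out_append pow_trans_append intro: generated_congruence.mult)
qed

theorem cong_act_eq:
  assumes "3 \<le> m" "cong m v w"
  shows "act_eq m v w"
proof -
  have "act m v u = act m w u" if "u \<in> lists {..<m}" for u
    using that assms(2)
  proof (induction u arbitrary: v w rule: list.induct)
    case (Cons x u)
    then show ?case using cong_step[OF assms(1) Cons.prems(2), of x] by simp
  qed simp
  then show ?thesis by (simp add: act_eq_def)
qed

theorem act_eq_iff_cong:
  assumes "3 \<le> m" "binary v" "v \<noteq> []" "binary w" "w \<noteq> []"
  shows "act_eq m v w \<longleftrightarrow> cong m v w"
proof
  assume eq: "act_eq m v w"
  obtain v' where v': "cong m v v'" "normal m v'" "length v' = length v"
    using normal_form_exists assms by blast
  obtain w' where w': "cong m w w'" "normal m w'" "length w' = length w"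
    using normal_form_exists assms by blast
  have "act_eq m v' w'"
    using cong_act_eq[OF assms(1) v'(1)] cong_act_eq[OF assms(1) w'(1)] eq
    by (auto simp: act_eq_def)
  moreover have "v' \<noteq> []" "w' \<noteq> []" using v'(3) w'(3) assms by auto
  ultimately have "v' = w'" using normal_act_eq assms(1) v'(2) w'(2) by blast
  then show "cong m v w" using v'(1) w'(1)
    by (blast intro: generated_congruence.trans generated_congruence.sym)
qed (rule cong_act_eq[OF assms(1)])

section \<open>Presentation of the semigroup\<close>

definition word_map :: "nat \<Rightarrow> nat list \<Rightarrow> nat list \<Rightarrow> nat list" where
  "word_map m w = restrict (act m w) (lists {..<m})"

lemma word_map_eq_iff: "word_map m v = word_map m w \<longleftrightarrow> act_eq m v w"
  unfolding word_map_def act_eq_def by (metis restrict_apply restrict_ext)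

lemma act_closed: "3 \<le> m \<Longrightarrow> u \<in> lists {..<m} \<Longrightarrow> act m w u \<in> lists {..<m}"
  by (induction u arbitrary: w rule: list.induct) (auto simp: letter_out_less)

lemma act_append: "act m (v @ w) u = act m v (act m w u)"
  by (simp add: act_def)

lemma word_map_singleton: "word_map m [q] = transf (B m) q"
  by (simp add: word_map_def transf_def act_def)

lemma word_map_append:
  "3 \<le> m \<Longrightarrow> word_map m (v @ w) = compose (lists {..<m}) (word_map m v) (word_map m w)"
  using act_closed by (auto simp: word_map_def compose_def act_append fun_eq_iff restrict_def)

lemma word_value_B:
  assumes "3 \<le> m" "w \<noteq> []"
  shows "word_value (compose (lists {..<m})) (transf (B m)) w = word_map m w"
  using assms(2)
proof (induction w rule: induct_list012)
  case (2 a)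
  then show ?case by (simp add: word_map_singleton)
next
  case (3 a b w)
  then show ?case
    using word_map_append[OF assms(1), of "[a]" "b # w"] by (simp add: word_map_singleton)
qed simp

lemma automaton_semigroup_B:
  assumes "3 \<le> m"
  shows "automaton_semigroup (B m) = word_map m ` free_semigroup {0, 1}"
proof (intro equalityI subsetI)
  fix f assume "f \<in> automaton_semigroup (B m)"
  then show "f \<in> word_map m ` free_semigroup {0, 1}"
  proof induction
    case (gen q)
    then show ?case by (intro image_eqI[of _ _ "[q]"]) (auto simp: word_map_singleton)
  next
    case (mult f g)
    then obtain v w where "f = word_map m v" "g = word_map m w"
      "v \<in> free_semigroup {0, 1}" "w \<in> free_semigroup {0, 1}" by blast
    then show ?case using word_map_append[OF assms, of v w]
      by (intro image_eqI[of _ _ "v @ w"]) auto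
  qed
next
  fix f assume "f \<in> word_map m ` free_semigroup {0, 1}"
  then obtain w where w: "f = word_map m w" "w \<noteq> []" "binary w" by auto
  have "word_map m w \<in> automaton_semigroup (B m)"
    using w(2,3)
  proof (induction w rule: list_nonempty_induct)
    case (single a)
    then show ?case
      using automaton_semigroup.gen[of a "B m"] by (auto simp: word_map_singleton)
  next
    case (cons a w)
    then have "transf (B m) a \<in> automaton_semigroup (B m)"
      by (intro automaton_semigroup.gen) auto
    then show ?case
      using automaton_semigroup.mult[of "transf (B m) a" "B m" "word_map m w"] cons
        word_map_append[OF assms, of "[a]" w] by (simp add: word_map_singleton)
  qed
  then show "f \<in> automaton_semigroup (B m)" using w by simp
qed

lemma semigroup_on_B:
  assumes "3 \<le> m"
  shows "semigroup_on (automaton_semigroup (B m)) (compose (lists {..<m}))"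
  unfolding semigroup_on_def
proof (intro conjI ballI)
  fix f g h
  assume "f \<in> automaton_semigroup (B m)" "g \<in> automaton_semigroup (B m)"
    "h \<in> automaton_semigroup (B m)"
  then obtain u v w where "f = word_map m u" "g = word_map m v" "h = word_map m w"
    unfolding automaton_semigroup_B[OF assms] by blast
  then show "compose (lists {..<m}) (compose (lists {..<m}) f g) h =
      compose (lists {..<m}) f (compose (lists {..<m}) g h)"
    using word_map_append[OF assms] by (metis append_assoc)
qed (use automaton_semigroup.mult[of _ "B m"] in auto)

theorem presentation_B:
  assumes "3 \<le> m"
  shows "semigroup_presentation (automaton_semigroup (B m)) (compose (lists {..<m})) {0, 1}
    (transf (B m)) (rels m)"
proof -
  have "word_value (compose (lists {..<m})) (transf (B m)) ` free_semigroup {0, 1} =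
      automaton_semigroup (B m)"
    unfolding automaton_semigroup_B[OF assms]
    by (rule image_cong) (auto simp: word_value_B[OF assms])
  moreover have "rels m \<subseteq> free_semigroup {0, 1} \<times> free_semigroup {0, 1}"
    by (auto simp: rels_def rels3_def split: if_splits dest: subsetD[OF binary_prod_word])
  moreover have "transf (B m) ` {0, 1} \<subseteq> automaton_semigroup (B m)"
    using automaton_semigroup.gen[of _ "B m"] by auto
  moreover have "word_value (compose (lists {..<m})) (transf (B m)) u =
      word_value (compose (lists {..<m})) (transf (B m)) v \<longleftrightarrow> cong m u v"
    if "u \<in> free_semigroup {0, 1}" "v \<in> free_semigroup {0, 1}" for u v
    using that by (simp add: word_value_B[OF assms] word_map_eq_iff act_eq_iff_cong[OF assms])
  ultimately show ?thesis
    unfolding semigroup_presentation_def using semigroup_on_B[OF assms] by blast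
qed

lemma rels_4:
  "rels 4 = {([1,1,1,1], [1,0,1,1])} \<union>
     {([1] @ zs p @ [1,0,1], [1] @ zs (p + 2) @ [1]) | p. True}"
proof -
  have "prod_word p (4 - 3) = [1] @ zs (p 1)" for p
    using prod_word_Suc[of p 0] by (simp add: One_nat_def)
  moreover have "zs (p + 2) @ [1] = zs p @ [0,0,1]" for p
    using zs_add2[of p] by simp
  moreover have "\<exists>q. q 1 = p" for p :: nat by (rule exI[of _ "\<lambda>_. p"]) simp
  ultimately show ?thesis
    by (auto simp: rels_def)
qed

section \<open>Presentations and finite presentability\<close>

lemma generated_congruence_mono:
  "generated_congruence Y R u v \<Longrightarrow> R \<subseteq> R' \<Longrightarrow> generated_congruence Y R' u v"
  by (induction rule: generated_congruence.induct) (auto intro: generated_congruence.intros)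

text \<open>A derivation is a finite tree and so uses finitely many relations.\<close>

lemma generated_congruence_finite:
  "generated_congruence Y R u v \<Longrightarrow> \<exists>R0\<subseteq>R. finite R0 \<and> generated_congruence Y R0 u v"
proof (induction rule: generated_congruence.induct)
  case (rel u v)
  then show ?case by (intro exI[of _ "{(u, v)}"]) (auto intro: generated_congruence.rel)
next
  case (refl u)
  then show ?case by (intro exI[of _ "{}"]) (auto intro: generated_congruence.refl)
next
  case (sym u v)
  then show ?case by (blast intro: generated_congruence.sym)
next
  case (trans u v w)
  then obtain R1 R2 where "R1 \<subseteq> R" "finite R1" "generated_congruence Y R1 u v"
    "R2 \<subseteq> R" "finite R2" "generated_congruence Y R2 v w" by blast
  then show ?case
    by (intro exI[of _ "R1 \<union> R2"])
      (auto intro: generated_congruence.trans[OF generated_congruence_mono generated_congruence_mono])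
next
  case (mult u v u' v')
  then obtain R1 R2 where "R1 \<subseteq> R" "finite R1" "generated_congruence Y R1 u v"
    "R2 \<subseteq> R" "finite R2" "generated_congruence Y R2 u' v'" by blast
  then show ?case
    by (intro exI[of _ "R1 \<union> R2"])
      (auto intro: generated_congruence.mult[OF generated_congruence_mono generated_congruence_mono])
qed

lemma generated_congruence_finite_family:
  assumes "finite P" "\<And>u v. (u, v) \<in> P \<Longrightarrow> generated_congruence Y R u v"
  shows "\<exists>R0\<subseteq>R. finite R0 \<and> (\<forall>(u, v)\<in>P. generated_congruence Y R0 u v)"
  using assms
proof (induction P)
  case empty
  then show ?case by auto
next
  case (insert x P)
  obtain u v where x: "x = (u, v)" by fastforce
  obtain R1 where R1: "R1 \<subseteq> R" "finite R1" "generated_congruence Y R1 u v"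
    using generated_congruence_finite insert.prems x by (meson insertI1)
  obtain R2 where R2: "R2 \<subseteq> R" "finite R2" "\<forall>(u, v)\<in>P. generated_congruence Y R2 u v"
    using insert by auto
  have "\<forall>(u, v)\<in>insert x P. generated_congruence Y (R1 \<union> R2) u v"
    using R1(3) R2(3) x
    by (auto intro: generated_congruence_mono[of _ R1] generated_congruence_mono[of _ R2])
  then show ?case using R1 R2 by (intro exI[of _ "R1 \<union> R2"]) simp
qed

lemma word_value_append:
  assumes "semigroup_on S mul" "\<phi> ` Y \<subseteq> S" "u \<in> free_semigroup Y" "v \<in> free_semigroup Y"
  shows "word_value mul \<phi> u \<in> S"
    "word_value mul \<phi> (u @ v) = mul (word_value mul \<phi> u) (word_value mul \<phi> v)"
proof -
  have S: "word_value mul \<phi> w \<in> S" if "w \<noteq> []" "w \<in> lists Y" for w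
    using that
  proof (induction w rule: induct_list012)
    case (3 a b w)
    then show ?case using assms(1,2) by (auto simp: semigroup_on_def)
  qed (use assms in auto)
  then show "word_value mul \<phi> u \<in> S" using assms(3) by (auto simp: free_semigroup_def)
  have v: "v \<noteq> []" "word_value mul \<phi> v \<in> S" using assms(4) S by (auto simp: free_semigroup_def)
  have "u \<noteq> []" "u \<in> lists Y" using assms(3) by (auto simp: free_semigroup_def)
  then show "word_value mul \<phi> (u @ v) = mul (word_value mul \<phi> u) (word_value mul \<phi> v)"
  proof (induction u rule: induct_list012)
    case (2 a)
    then show ?case using v(1) by (cases v) auto
  next
    case (3 a b w)
    then have "\<phi> a \<in> S" "word_value mul \<phi> (b # w) \<in> S" using assms(2) S by auto
    then show ?case using 3 v(2) assms(1) by (auto simp: semigroup_on_def)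
  qed simp
qed

lemma word_value_concat:
  assumes "semigroup_on S mul" "\<phi> ` Y \<subseteq> S" "\<And>y. y \<in> Z \<Longrightarrow> t y \<in> free_semigroup Y"
    "w \<in> free_semigroup Z"
  shows "concat (map t w) \<in> free_semigroup Y"
    "word_value mul \<phi> (concat (map t w)) = word_value mul (\<lambda>y. word_value mul \<phi> (t y)) w"
proof -
  have "w \<noteq> []" "w \<in> lists Z" using assms(4) by (auto simp: free_semigroup_def)
  then have "concat (map t w) \<in> free_semigroup Y \<and>
    word_value mul \<phi> (concat (map t w)) = word_value mul (\<lambda>y. word_value mul \<phi> (t y)) w"
  proof (induction w rule: induct_list012)
    case (3 a b w)
    then have a: "t a \<in> free_semigroup Y" and
      IH: "concat (map t (b # w)) \<in> free_semigroup Y"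
      "word_value mul \<phi> (concat (map t (b # w))) = word_value mul (\<lambda>y. word_value mul \<phi> (t y)) (b # w)"
      using assms(3) by auto
    then show ?case using word_value_append(2)[OF assms(1,2) a IH(1)]
      by (auto simp: free_semigroup_def)
  qed (use assms(3) in auto)
  then show "concat (map t w) \<in> free_semigroup Y"
    "word_value mul \<phi> (concat (map t w)) = word_value mul (\<lambda>y. word_value mul \<phi> (t y)) w"
    by auto
qed

lemma generated_congruence_map:
  assumes "generated_congruence Z R u v" "\<And>y. y \<in> Z \<Longrightarrow> t y \<in> free_semigroup Y"
    "\<And>u v. (u, v) \<in> R \<Longrightarrow> generated_congruence Y R' (concat (map t u)) (concat (map t v))"
  shows "generated_congruence Y R' (concat (map t u)) (concat (map t v))"
  using assms(1)
proof induction
  case (refl u)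
  have "concat (map t u) \<in> free_semigroup Y"
    using refl
  proof (induction u)
    case (Cons a u)
    then show ?case using assms(2)[of a] by (cases "u = []") (auto simp: free_semigroup_def)
  qed (simp add: free_semigroup_def)
  then show ?case by (rule generated_congruence.refl)
qed (use assms(3) in \<open>auto intro: generated_congruence.intros\<close>)

text \<open>Finite presentability does not depend on the generating set: rewriting the relations of a
  finite presentation, and the change of generators and back, in the generators \<open>Y\<close> uses only
  finitely many of the relations \<open>R\<close>, and these imply all others.\<close>

theorem finitely_presented_finite_subset:
  assumes "semigroup_presentation S mul Y \<phi> R" "finite Y" "finitely_presented S mul"
  obtains R0 where "R0 \<subseteq> R" "finite R0"
    "\<And>u v. generated_congruence Y R u v \<Longrightarrow> generated_congruence Y R0 u v"
proof -
  obtain Z :: "nat set" and \<psi> Q where Z: "finite Z" "finite Q" "semigroup_presentation S mul Z \<psi> Q"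
    using assms(3) by (auto simp: finitely_presented_def)
  note P = assms(1)[unfolded semigroup_presentation_def]
  note P' = Z(3)[unfolded semigroup_presentation_def]
  have sg: "semigroup_on S mul" using P by blast
  have "\<exists>w\<in>free_semigroup Y. word_value mul \<phi> w = \<psi> z" if "z \<in> Z" for z
    using P P' that by (metis (no_types, lifting) image_iff image_subset_iff)
  then obtain t where t: "\<And>z. z \<in> Z \<Longrightarrow> t z \<in> free_semigroup Y \<and> word_value mul \<phi> (t z) = \<psi> z"
    by metis
  have "\<exists>w\<in>free_semigroup Z. word_value mul \<psi> w = \<phi> y" if "y \<in> Y" for y
    using P P' that by (metis (no_types, lifting) image_iff image_subset_iff)
  then obtain s where s: "\<And>y. y \<in> Y \<Longrightarrow> s y \<in> free_semigroup Z \<and> word_value mul \<psi> (s y) = \<phi> y"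
    by metis
  let ?t = "\<lambda>w. concat (map t w)" and ?s = "\<lambda>w. concat (map s w)"
  have cong_t: "word_value mul (\<lambda>z. word_value mul \<phi> (t z)) w = word_value mul \<psi> w"
    if "w \<in> free_semigroup Z" for w
  proof -
    have "w \<in> lists Z" using that by (simp add: free_semigroup_def)
    then show ?thesis by (induction w rule: induct_list012) (auto simp: t)
  qed
  have cong_s: "word_value mul (\<lambda>y. word_value mul \<psi> (s y)) w = word_value mul \<phi> w"
    if "w \<in> free_semigroup Y" for w
  proof -
    have "w \<in> lists Y" using that by (simp add: free_semigroup_def)
    then show ?thesis by (induction w rule: induct_list012) (auto simp: s)
  qed
  have t_val: "?t w \<in> free_semigroup Y" "word_value mul \<phi> (?t w) = word_value mul \<psi> w"
    if "w \<in> free_semigroup Z" for w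
    using word_value_concat[OF sg, of \<phi> Y Z t w] P t that cong_t[OF that] by auto
  have s_val: "?s w \<in> free_semigroup Z" "word_value mul \<psi> (?s w) = word_value mul \<phi> w"
    if "w \<in> free_semigroup Y" for w
    using word_value_concat[OF sg, of \<psi> Z Y s w] P' s that cong_s[OF that] by auto
  have single: "[y] \<in> free_semigroup Y" if "y \<in> Y" for y using that by (simp add: free_semigroup_def)
  \<comment> \<open>Here \<open>t\<close> expresses the generators in \<open>Z\<close> by those in
    \<open>Y\<close>, and \<open>s\<close> does the reverse. The second kind of pairs undoes the
    round trip on each generator.\<close>
  define G where "G = (\<lambda>(u, v). (?t u, ?t v)) ` Q \<union> (\<lambda>y. (?t (s y), [y])) ` Y"
  have "generated_congruence Y R u v" if G: "(u, v) \<in> G" for u v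
  proof -
    consider a b where "(a, b) \<in> Q" "u = ?t a" "v = ?t b" | y where "y \<in> Y" "u = ?t (s y)" "v = [y]"
      using G by (auto simp: G_def)
    then show ?thesis
    proof cases
      case 1
      then have "a \<in> free_semigroup Z" "b \<in> free_semigroup Z" using P' by auto
      moreover have "word_value mul \<psi> a = word_value mul \<psi> b"
        using P' 1(1) calculation generated_congruence.rel by metis
      ultimately show ?thesis using 1 P t_val by metis
    next
      case 2
      then have "word_value mul \<phi> u = word_value mul \<phi> v" using t_val(2) s by simp
      then show ?thesis using P t_val(1) s single 2 by metis
    qed
  qed
  moreover have "finite G" using Z(2) assms(2) by (simp add: G_def)
  ultimately obtain R0 where R0: "R0 \<subseteq> R" "finite R0" "\<forall>(u, v)\<in>G. generated_congruence Y R0 u v"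
    using generated_congruence_finite_family[of G Y R] by blast
  have ts: "generated_congruence Y R0 (?t (?s w)) w" if "w \<in> free_semigroup Y" for w
  proof -
    have "w \<noteq> []" "w \<in> lists Y" using that by (auto simp: free_semigroup_def)
    then show ?thesis
    proof (induction w rule: list_nonempty_induct)
      case (single y)
      then show ?case using R0(3) by (auto simp: G_def)
    next
      case (cons y w)
      have "generated_congruence Y R0 (?t (s y)) [y]" using R0(3) cons.prems by (auto simp: G_def)
      then show ?case using generated_congruence.mult[of Y R0 "?t (s y)" "[y]" "?t (?s w)" w] cons
        by simp
    qed
  qed
  show thesis
  proof (rule that[OF R0(1,2)])
    fix u v assume uv: "generated_congruence Y R u v"
    have R: "R \<subseteq> free_semigroup Y \<times> free_semigroup Y" using P by blast
    have "u \<in> free_semigroup Y \<and> v \<in> free_semigroup Y"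
      using uv by induction (use R in \<open>auto simp: free_semigroup_def\<close>)
    then have Y: "u \<in> free_semigroup Y" "v \<in> free_semigroup Y" by auto
    \<comment> \<open>Translated by \<open>s\<close>, equal elements are already equated by
      \<open>Q\<close>; translating that derivation by \<open>t\<close> gives one over
      \<open>R0\<close>.\<close>
    then have "word_value mul \<psi> (?s u) = word_value mul \<psi> (?s v)" using P uv s_val by metis
    then have "generated_congruence Z Q (?s u) (?s v)" using P' Y s_val by metis
    moreover have "generated_congruence Y R0 (?t a) (?t b)" if "(a, b) \<in> Q" for a b
    proof -
      have "(?t a, ?t b) \<in> G" using that by (force simp: G_def)
      then show ?thesis using R0(3) by blast
    qed
    ultimately have "generated_congruence Y R0 (?t (?s u)) (?t (?s v))"
      using t by (auto elim: generated_congruence_map)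
    then show "generated_congruence Y R0 u v"
      using ts[OF Y(1)] ts[OF Y(2)] generated_congruence.trans generated_congruence.sym by metis
  qed
qed

section \<open>Infinite presentation for \<open>m \<ge> 4\<close>\<close>

lemma prod_word_Cons: "0 < r \<Longrightarrow> \<exists>t. prod_word p r = 1 # t"
proof (induction r)
  case (Suc r)
  then show ?case by (cases "r = 0") (auto simp: prod_word_Suc)
qed simp

text \<open>These features keep a side out of a word made of \<open>m - 3\<close> symbols 1, a long
  gap and \<open>1 0 1\<close>: it has too many symbols 1 for the first block and too many letters
  for the last, so it would have to span the gap.\<close>

lemma rels_sides:
  assumes "4 \<le> m" "(u, v) \<in> rels m" "w = u \<or> w = v"
  shows "hd w = 1" "last w = 1" "m \<le> ones w + 2" "4 \<le> length w"
proof -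
  consider p s where "w = prod_word p (m - 4) @ 1 # s @ [1]" "1 \<le> ones s" "2 \<le> length s" |
    p s where "w = prod_word p (m - 3) @ s @ [1]" "2 \<le> length s"
    using assms by (force simp: rels_def)
  then have "hd w = 1 \<and> last w = 1 \<and> m \<le> ones w + 2 \<and> 4 \<le> length w"
  proof cases
    case 1
    have "hd (prod_word p (m - 4) @ 1 # s @ [1]) = 1"
      using prod_word_Cons[of "m - 4" p] assms(1) by (cases "m = 4") auto
    then show ?thesis using 1 assms(1) by simp
  next
    case (2 p s)
    obtain t where t: "prod_word p (m - 3) = 1 # t" using prod_word_Cons[of "m - 3" p] assms(1) by auto
    then have "hd w = 1" "4 \<le> length w" using 2 by simp_all
    then show ?thesis using 2(1) assms(1) by simp
  qed
  then show "hd w = 1" "last w = 1" "m \<le> ones w + 2" "4 \<le> length w" by auto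
qed

text \<open>Relations shorter than \<open>N\<close> cannot be applied to \<open>f_1^{m-3} f_0^N f_1 f_0 f_1\<close>, although
  this word represents the same element as \<open>f_1^{m-3} f_0^{N+2} f_1\<close>.\<close>

lemma isolated_word:
  assumes "hd w = 1" "last w = 1" "k < ones w" "4 \<le> length w" "length w \<le> N"
  shows "a @ w @ b \<noteq> replicate k 1 @ zs N @ [1,0,1]"
proof
  let ?W = "replicate k (1::nat) @ zs N @ [1,0,1]"
  assume eq: "a @ w @ b = ?W"
  have gap: "i < k \<or> k + N \<le> i" if "?W ! i = 1" for i
  proof (rule ccontr)
    assume "\<not> (i < k \<or> k + N \<le> i)"
    then have "\<not> i < k" "i - k < N" by linarith+
    then have "?W ! i = 0" by (simp add: nth_append)
    then show False using that by simp
  qed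
  define j where "j = length a + (length w - 1)"
  have w: "w \<noteq> []" using assms(4) by auto
  have "?W ! length a = 1"
    unfolding eq[symmetric] using w assms(1) by (simp add: nth_append hd_conv_nth)
  moreover have "?W ! j = 1"
    unfolding eq[symmetric] using w assms(2) by (simp add: nth_append last_conv_nth j_def)
  moreover have "length a + length w \<le> k + N + 3" using arg_cong[OF eq, of length] by simp
  moreover have "ones w \<le> length w" by (rule count_le_length)
  \<comment> \<open>Both ends of \<open>w\<close> lie in the first block, both among the last three
    symbols, or on opposite sides of the gap. These cases contradict \<open>k < ones w\<close>,
    \<open>4 \<le> length w\<close> and \<open>length w \<le> N\<close>.\<close>
  ultimately show False
    using gap[of "length a"] gap[of j] assms(3-5) unfolding j_def by linarith
qed

theorem not_finitely_presented_B:
  assumes "4 \<le> m"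
  shows "\<not> finitely_presented (automaton_semigroup (B m)) (compose (lists {..<m}))"
proof
  assume fp: "finitely_presented (automaton_semigroup (B m)) (compose (lists {..<m}))"
  have m: "3 \<le> m" and fin: "finite {0, 1::nat}" using assms by simp_all
  obtain R where R: "R \<subseteq> rels m" "finite R"
    "\<And>u v. cong m u v \<Longrightarrow> generated_congruence {0, 1} R u v"
    using finitely_presented_finite_subset[OF presentation_B[OF m] fin fp] by blast
  define N where "N = (\<Sum>(u, v)\<in>R. length u + length v)"
  have N: "length u + length v \<le> N" if "(u, v) \<in> R" for u v
    using member_le_sum[OF that, of "\<lambda>(u, v). length u + length v"] R(2) by (simp add: N_def)
  let ?W = "replicate (m - 3) 1 @ zs N @ [1,0,1]"
  \<comment> \<open>Quantifying over the contexts \<open>a\<close> and \<open>b\<close> makes this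
    invariant stable under products. It says that \<open>R\<close> rewrites \<open>?W\<close> only
    to itself.\<close>
  have "a @ u @ b = ?W \<longleftrightarrow> a @ v @ b = ?W" if "generated_congruence {0, 1} R u v" for u v a b
    using that
  proof (induction arbitrary: a b)
    case (rel u v)
    have "a @ w @ b \<noteq> ?W" if "w = u \<or> w = v" for w
    proof -
      have uv: "(u, v) \<in> rels m" using rel R(1) by auto
      show ?thesis
        using rels_sides[OF assms uv that] N[OF rel] that assms by (intro isolated_word) auto
    qed
    then show ?case by blast
  next
    case (mult u v u' v')
    then show ?case by (metis append_assoc)
  qed auto
  moreover have "cong m ?W (replicate (m - 3) 1 @ zs N @ [0,0,1])"
  proof -
    have u: "binary (replicate (m - 3) 1 @ zs N)" "m \<le> ones (replicate (m - 3) 1 @ zs N) + 3"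
      by auto
    show ?thesis using cong_odd_gap[OF assms u, of "[]"] by simp
  qed
  ultimately have "[] @ ?W @ [] = ?W \<longleftrightarrow> [] @ (replicate (m - 3) 1 @ zs N @ [0,0,1]) @ [] = ?W"
    using R(3) by blast
  then show False by simp
qed

section \<open>Counting normal forms\<close>

lemma card_binary_ones: "card {w. binary w \<and> length w = n \<and> ones w = i} = n choose i"
proof (induction n arbitrary: i)
  case 0
  have "{w. binary w \<and> length w = 0 \<and> ones w = i} = (if i = 0 then {[]} else {})" by auto
  then show ?case by simp
next
  case (Suc n)
  let ?S = "\<lambda>n i. {w. binary w \<and> length w = n \<and> ones w = i}"
  have fin: "finite (?S n i)" for n i
    using finite_lists_length_eq[of "{0, 1::nat}" n] by (rule rev_finite_subset) auto
  show ?case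
  proof (cases i)
    case 0
    have "?S (Suc n) 0 = (#) 0 ` ?S n 0" by (auto simp: length_Suc_conv image_iff)
    then show ?thesis using 0 Suc by (simp add: card_image)
  next
    case (Suc k)
    have "?S (Suc n) (Suc k) = (#) 0 ` ?S n (Suc k) \<union> (#) 1 ` ?S n k"
      by (auto simp: length_Suc_conv image_iff)
    moreover have "card ((#) 0 ` ?S n (Suc k) \<union> (#) 1 ` ?S n k) =
        card ((#) 0 ` ?S n (Suc k)) + card ((#) 1 ` ?S n k)"
      by (rule card_Un_disjoint) (use fin in auto)
    ultimately show ?thesis using Suc Suc.IH by (simp add: card_image)
  qed
qed

lemma zs_one_inj: "zs c @ 1 # v = zs c' @ 1 # v' \<Longrightarrow> c = c' \<and> v = v'"
proof (induction c arbitrary: c')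
  case 0
  then show ?case by (cases c') auto
next
  case (Suc c)
  then show ?case by (cases c') auto
qed

lemma last_one_inj:
  assumes "v @ [1] @ zs c = v' @ [1] @ zs c'"
  shows "v = v' \<and> c = c'"
proof -
  have "zs c @ 1 # rev v = zs c' @ 1 # rev v'" using arg_cong[OF assms, of rev] by simp
  then show ?thesis using zs_one_inj rev_is_rev_conv by blast
qed

text \<open>For fixed \<open>j\<close>, deleting the even gap and one 1 next to it is a bijection
  onto all words of length \<open>n - 2 * j - 1\<close> with \<open>m - 2\<close> symbols 1.\<close>

lemma card_even_gap_words:
  assumes "3 \<le> m"
  shows "card {v @ [1] @ zs (2 * j) @ [1] @ zs c | v j c.
      binary v \<and> ones v + 3 = m \<and> length v + 2 * j + c + 2 = n} =
    (\<Sum>j | 2 * j + 1 \<le> n. (n - 2 * j - 1) choose (m - 2))"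
proof -
  define D where "D j = {(v, c). binary v \<and> ones v + 3 = m \<and> length v + 2 * j + c + 2 = n}" for j
  let ?g = "\<lambda>(v, c). v @ [1] @ zs c"
  let ?h = "\<lambda>(j, v, c). v @ [1] @ zs (2 * j) @ [1] @ zs c"
  let ?J = "{j. 2 * j + 1 \<le> n}"
  have g: "inj_on ?g A" for A
    by (rule inj_onI) (use last_one_inj in \<open>fast\<close>)
  have img: "?g ` D j = {w. binary w \<and> length w = n - 2 * j - 1 \<and> ones w = m - 2}"
    if "j \<in> ?J" for j
  proof (intro equalityI subsetI)
    fix w assume "w \<in> ?g ` D j"
    then show "w \<in> {w. binary w \<and> length w = n - 2 * j - 1 \<and> ones w = m - 2}"
      by (auto simp: D_def)
  next
    fix w assume w: "w \<in> {w. binary w \<and> length w = n - 2 * j - 1 \<and> ones w = m - 2}"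
    then have "binary w" "ones w = Suc (m - 3)" using assms by auto
    then obtain v c where v: "w = v @ [1] @ zs c" "binary v" "ones v = m - 3"
      by (rule split_last_one)
    have "Suc (length v + c) = n - 2 * j - 1" using w v(1) by simp
    then have "(v, c) \<in> D j" using v(2,3) assms by (simp add: D_def)
    then show "w \<in> ?g ` D j" using v(1) by (intro image_eqI[of _ _ "(v, c)"]) simp_all
  qed
  have card_D: "card (D j) = (n - 2 * j - 1) choose (m - 2)" if "j \<in> ?J" for j
    using card_image[OF g, of "D j"] img[OF that] card_binary_ones by simp
  have fin: "finite (D j)" if "j \<in> ?J" for j
  proof -
    have "finite (?g ` D j)"
      unfolding img[OF that]
      by (rule finite_subset[OF _ finite_lists_length_eq[of "{0, 1::nat}" "n - 2 * j - 1"]]) auto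
    then show ?thesis using finite_imageD[OF _ g] by blast
  qed
  have finJ: "finite ?J" by (rule finite_subset[of _ "{..n}"]) auto
  have "{v @ [1] @ zs (2 * j) @ [1] @ zs c | v j c.
      binary v \<and> ones v + 3 = m \<and> length v + 2 * j + c + 2 = n} = ?h ` (SIGMA j:?J. D j)"
    (is "?H = _")
  proof (intro equalityI subsetI)
    fix w assume "w \<in> ?H"
    then obtain v j c where "w = ?h (j, v, c)" "binary v" "ones v + 3 = m"
      "length v + 2 * j + c + 2 = n" by auto
    then show "w \<in> ?h ` (SIGMA j:?J. D j)" by (intro image_eqI[of _ _ "(j, v, c)"]) (auto simp: D_def)
  next
    fix w assume "w \<in> ?h ` (SIGMA j:?J. D j)"
    then obtain j v c where "w = ?h (j, v, c)" "(v, c) \<in> D j" by auto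
    then show "w \<in> ?H" unfolding D_def by auto
  qed
  moreover have "inj_on ?h (SIGMA j:?J. D j)"
  proof (rule inj_onI)
    fix s t assume st: "?h s = ?h t"
    obtain j v c where s: "s = (j, v, c)" by (cases s)
    obtain j' v' c' where t: "t = (j', v', c')" by (cases t)
    have "v @ [1] @ zs (2 * j) @ [1] @ zs c = v' @ [1] @ zs (2 * j') @ [1] @ zs c'"
      using st s t by simp
    then have "(v @ [1] @ zs (2 * j)) @ [1] @ zs c = (v' @ [1] @ zs (2 * j')) @ [1] @ zs c'" by simp
    from last_one_inj[OF this] have c: "c = c'" and eq: "v @ [1] @ zs (2 * j) = v' @ [1] @ zs (2 * j')"
      by simp_all
    from last_one_inj[OF eq] c show "s = t" using s t by simp
  qed
  ultimately show ?thesis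
    using card_SigmaI[OF finJ, of D] fin card_D by (simp add: card_image)
qed

lemma card_normal:
  assumes "3 \<le> m"
  shows "card {w. normal m w \<and> length w = n} =
    (\<Sum>i=0..m - 2. n choose i) + (\<Sum>j | 2 * j + 1 \<le> n. (n - 2 * j - 1) choose (m - 2))"
proof -
  let ?L = "{w. binary w \<and> length w = n \<and> ones w \<in> {0..m - 2}}"
  let ?H = "{v @ [1] @ zs (2 * j) @ [1] @ zs c | v j c.
      binary v \<and> ones v + 3 = m \<and> length v + 2 * j + c + 2 = n}"
  let ?S = "\<lambda>i. {w. binary w \<and> length w = n \<and> ones w = i}"
  have fin: "finite {w. binary w \<and> length w = n}"
    using finite_lists_length_eq[of "{0, 1::nat}" n] by simp
  have "{w. normal m w \<and> length w = n} = ?L \<union> ?H"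
  proof (intro equalityI subsetI)
    fix w assume w: "w \<in> {w. normal m w \<and> length w = n}"
    then consider "ones w + 2 \<le> m"
      | v j c where "w = v @ [1] @ zs (2 * j) @ [1] @ zs c" "ones v + 3 = m"
      unfolding normal_def by blast
    then show "w \<in> ?L \<union> ?H"
    proof cases
      case 1
      then have "ones w \<le> m - 2" by simp
      then have "w \<in> ?L" using w by (simp add: normal_def)
      then show ?thesis by blast
    next
      case 2
      then have "binary v" "length v + 2 * j + c + 2 = n" using w by (auto simp: normal_def)
      then have "w \<in> ?H" using 2 by blast
      then show ?thesis by blast
    qed
  next
    fix w assume "w \<in> ?L \<union> ?H"
    then show "w \<in> {w. normal m w \<and> length w = n}"
    proof
      assume "w \<in> ?L"
      then show ?thesis using assms by (auto simp: normal_def)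
    next
      assume "w \<in> ?H"
      then obtain v j c where *: "w = v @ [1] @ zs (2 * j) @ [1] @ zs c" "binary v"
        "ones v + 3 = m" "length v + 2 * j + c + 2 = n" by blast
      then have "binary w" "length w = n" by auto
      then show ?thesis unfolding normal_def using *(1,3) by blast
    qed
  qed
  moreover have "?L \<inter> ?H = {}" using assms by auto
  moreover have "finite ?L" "finite ?H"
    by (rule finite_subset[OF _ fin]; force)+
  moreover have "card ?L = (\<Sum>i=0..m - 2. n choose i)"
  proof -
    have "?L = (\<Union>i\<in>{0..m - 2}. ?S i)" by auto
    moreover have "card (\<Union>i\<in>{0..m - 2}. ?S i) = (\<Sum>i=0..m - 2. card (?S i))"
      by (rule card_UN_disjoint) (auto intro: finite_subset[OF _ fin])
    ultimately show ?thesis by (simp add: card_binary_ones)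
  qed
  ultimately show ?thesis using card_even_gap_words[OF assms, of n] by (simp add: card_Un_disjoint)
qed

section \<open>Growth\<close>

lemma transf_eqD: "transf A p = transf A q \<Longrightarrow> u \<in> input_words A \<Longrightarrow> run A p u = run A q u"
  by (metis transf_def restrict_apply')

text \<open>The states number the distinct transformations, and transitions are computed at chosen
  representatives. Equal transformations have equal runs, so the choice does not affect the
  result.\<close>

lemma minimal_automaton_exists:
  assumes "mealy_automaton A"
  shows "\<exists>C :: nat mealy. mealy_automaton C \<and> mealy_equivalent C A \<and> card (states C) = card (transf A ` states A)"
proof -
  note A = assms[unfolded mealy_automaton_def]
  let ?F = "transf A ` states A"
  have "finite ?F" using A by blast
  then obtain e where e: "bij_betw e {0..<card ?F} ?F" using ex_bij_betw_nat_finite by blast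
  define ix where "ix = inv_into {0..<card ?F} e"
  have ix: "ix g < card ?F" "e (ix g) = g" if "g \<in> ?F" for g
    using bij_betw_imp_surj_on[OF e] that inv_into_into[of g e "{0..<card ?F}"]
      f_inv_into_f[of g e "{0..<card ?F}"] by (auto simp: ix_def)
  have "\<exists>q\<in>states A. transf A q = e i" if "i < card ?F" for i
    using bij_betw_apply[OF e, of i] that by auto
  then obtain h where h: "\<And>i. i < card ?F \<Longrightarrow> h i \<in> states A \<and> transf A (h i) = e i"
    by metis
  define C where "C = \<lparr>alph = alph A, states = {0..<card ?F},
    trans = (\<lambda>x i. ix (transf A (trans A x (h i)))), out = (\<lambda>x i. out A x (h i))\<rparr>"
  have C: "alph C = alph A" "states C = {0..<card ?F}"
    "trans C x i = ix (transf A (trans A x (h i)))" "out C x i = out A x (h i)" for x i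
    by (simp_all add: C_def)
  have run: "run C i u = run A (h i) u" if "u \<in> input_words A" "i < card ?F" for i u
    using that
  proof (induction u arbitrary: i rule: list.induct)
    case (Cons x u)
    let ?q = "trans A x (h i)"
    have "x < alph A" using Cons.prems by (simp add: input_words_def)
    then have q: "transf A ?q \<in> ?F" using A h[OF Cons.prems(2)] by blast
    have u: "u \<in> input_words A" using Cons.prems by (simp add: input_words_def)
    have "run C (ix (transf A ?q)) u = run A (h (ix (transf A ?q))) u"
      using Cons.IH u ix(1)[OF q] by blast
    also have "\<dots> = run A ?q u"
      using h[OF ix(1)[OF q]] ix(2)[OF q] u by (intro transf_eqD) auto
    finally show ?case by (simp add: C)
  qed simp
  have "transf C i = e i" if "i < card ?F" for i
  proof -
    have "transf C i = transf A (h i)"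
      unfolding transf_def input_words_def C(1) using run that
      by (intro restrict_ext) (simp add: input_words_def)
    then show ?thesis using h that by simp
  qed
  then have "transf C ` {0..<card ?F} = e ` {0..<card ?F}" by (intro image_cong) simp_all
  then have "transf C ` states C = ?F" using bij_betw_imp_surj_on[OF e] by (simp only: C(2))
  then have "mealy_equivalent C A" using C by (simp add: mealy_equivalent_def)
  moreover have "mealy_automaton C"
    unfolding mealy_automaton_def using A h ix by (auto simp: C card_gt_0_iff)
  ultimately show ?thesis using C(2) by auto
qed

text \<open>An equivalent automaton needs at least one state per transformation, and this bound is
  attained, so every choice by \<open>SOME\<close> has this size.\<close>

lemma growth_eq_card:
  assumes "mealy_automaton (mealy_power A n)"
  shows "growth A n = card (transf (mealy_power A n) ` states (mealy_power A n))"
proof -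
  let ?A = "mealy_power A n"
  let ?N = "card (transf ?A ` states ?A)"
  have le: "?N \<le> card (states C)" if "mealy_automaton C" "mealy_equivalent C ?A"
    for C :: "nat mealy"
    using that card_image_le[of "states C" "transf C"]
    by (simp add: mealy_automaton_def mealy_equivalent_def)
  obtain C :: "nat mealy" where C: "mealy_automaton C" "mealy_equivalent C ?A" "card (states C) = ?N"
    using minimal_automaton_exists[OF assms] by blast
  then have "minimal_automaton ?A C" using le by (simp add: minimal_automaton_def)
  then have "minimal_automaton ?A (SOME B. minimal_automaton ?A B)" by (rule someI)
  then have "card (states (SOME B. minimal_automaton ?A B)) = ?N"
    using le C by (metis le_antisym minimal_automaton_def)
  then show ?thesis by (simp add: growth_def)
qed

text \<open>Reduction to normal form keeps the length, so products of exactly \<open>n\<close>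
  generators correspond to normal forms of length \<open>n\<close>.\<close>

theorem growth_B:
  assumes "3 \<le> m" "1 \<le> n"
  shows "growth (B m) n = card {w. normal m w \<and> length w = n}"
proof -
  let ?P = "mealy_power (B m) n"
  let ?W = "{w. binary w \<and> length w = n}"
  have P: "alph ?P = m" "states ?P = ?W" "trans ?P = pow_trans (B m)" "out ?P = pow_out (B m)"
    by (simp_all add: mealy_power_def)
  have run: "run ?P w u = act m w u" for w u
    by (induction u arbitrary: w) (simp_all add: P)
  have transf: "transf ?P w = word_map m w" for w
    unfolding transf_def word_map_def input_words_def P(1) by (rule restrict_ext) (rule run)
  have fin: "finite ?W" using finite_lists_length_eq[of "{0, 1::nat}" n] by simp
  have "zs n \<in> ?W" by simp
  then have "?W \<noteq> {}" by blast
  then have "mealy_automaton ?P"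
    using fin letter_out_less[OF _ assms(1)] binary_next_word
    by (auto simp: mealy_automaton_def P)
  then have "growth (B m) n = card (word_map m ` ?W)"
    using growth_eq_card P transf by (metis image_cong)
  also have "word_map m ` ?W = word_map m ` {w. normal m w \<and> length w = n}"
  proof (intro equalityI subsetI)
    fix f assume "f \<in> word_map m ` ?W"
    then obtain w where w: "f = word_map m w" "binary w" "length w = n" by auto
    then obtain v where "cong m w v" "normal m v" "length v = length w"
      using normal_form_exists[OF assms(1), of w] assms(2) by fastforce
    then show "f \<in> word_map m ` {w. normal m w \<and> length w = n}"
      using w cong_act_eq[OF assms(1)] word_map_eq_iff by (intro image_eqI[of _ _ v]) auto
  qed (auto simp: normal_def)
  also have "card \<dots> = card {w. normal m w \<and> length w = n}"
  proof (rule card_image, rule inj_onI)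
    fix v w assume vw: "v \<in> {w. normal m w \<and> length w = n}" "w \<in> {w. normal m w \<and> length w = n}"
      "word_map m v = word_map m w"
    then have "v \<noteq> []" "w \<noteq> []" using assms(2) by auto
    then show "v = w"
      using normal_act_eq[OF assms(1), of v w] vw by (simp add: word_map_eq_iff)
  qed
  finally show ?thesis .
qed

section \<open>The two sums in the growth function\<close>

lemma ibinom_diff:
  "ibinom (int n - 2 * int j - 1) k = (if 2 * j + 1 \<le> n then (n - 2 * j - 1) choose k else 0)"
proof (cases "2 * j + 1 \<le> n")
  case True
  then have "int n - 2 * int j - 1 = int (n - 2 * j - 1)" by simp
  then show ?thesis using True unfolding ibinom_def by (simp only: nat_int) simp
qed (simp add: ibinom_def)

text \<open>The upper limit cuts off exactly the summands with \<open>n - 2 * j - 1\<close> below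
  \<open>m - 2\<close>, which vanish. For \<open>n < m - 1\<close> the limit is negative and the
  integer interval empty.\<close>

lemma sum_ibinom_floor:
  assumes "3 \<le> m"
  shows "(\<Sum>i=0..\<lfloor>(real n - real m + 1) / 2\<rfloor>. ibinom (int n - 2 * i - 1) (m - 2)) =
    (\<Sum>j | 2 * j + 1 \<le> n. (n - 2 * j - 1) choose (m - 2))"
proof -
  let ?K = "\<lfloor>(real n - real m + 1) / 2\<rfloor>"
  have K: "int j \<le> ?K \<longleftrightarrow> 2 * j + m \<le> n + 1" for j
    by (simp add: le_floor_iff field_simps) linarith
  have "{0..?K} = int ` {j. int j \<le> ?K}"
  proof (intro equalityI subsetI)
    fix i assume "i \<in> {0..?K}"
    then show "i \<in> int ` {j. int j \<le> ?K}" by (intro image_eqI[of _ _ "nat i"]) auto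
  qed auto
  then have "(\<Sum>i=0..?K. ibinom (int n - 2 * i - 1) (m - 2)) =
      (\<Sum>j | int j \<le> ?K. ibinom (int n - 2 * int j - 1) (m - 2))"
    by (simp add: sum.reindex)
  also have "\<dots> = (\<Sum>j | 2 * j + m \<le> n + 1. (n - 2 * j - 1) choose (m - 2))"
    unfolding K by (rule sum.cong) (use assms in \<open>auto simp: ibinom_diff\<close>)
  also have "\<dots> = (\<Sum>j | 2 * j + 1 \<le> n. (n - 2 * j - 1) choose (m - 2))"
  proof (rule sum.mono_neutral_left)
    show "finite {j. 2 * j + 1 \<le> n}" by (rule finite_subset[of _ "{..n}"]) auto
  qed (use assms in auto)
  finally show ?thesis .
qed

lemma suminf_ibinom:
  "(\<Sum>i. ibinom (int n - 2 * int i - 1) k) = (\<Sum>j | 2 * j + 1 \<le> n. (n - 2 * j - 1) choose k)"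
proof -
  have "finite {j. 2 * j + 1 \<le> n}" by (rule finite_subset[of _ "{..n}"]) auto
  then show ?thesis by (subst suminf_finite[of "{j. 2 * j + 1 \<le> n}"]) (auto simp: ibinom_diff)
qed

theorem theorem5p1:
  fixes m :: nat
  assumes "m \<ge> 3"
  defines "S \<equiv> automaton_semigroup (B m)"
    and "mul \<equiv> compose (input_words (B m))"
    and "f \<equiv> transf (B m)"
  shows
    "(m = 3 \<longrightarrow> semigroup_presentation S mul {0, 1} f
        {([1,1,1], [0,1,1]), ([1,0,1], [0,0,1])})
   \<and> (m = 4 \<longrightarrow> semigroup_presentation S mul {0, 1} f
        ({([1,1,1,1], [1,0,1,1])} \<union>
         {([1] @ replicate p 0 @ [1,0,1], [1] @ replicate (p + 2) 0 @ [1]) | p. True}))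
   \<and> (m \<ge> 5 \<longrightarrow> semigroup_presentation S mul {0, 1} f
        ({(prod_word p (m - 4) @ [1,1,1,1], prod_word p (m - 4) @ [1,0,1,1]) | p. True} \<union>
         {(prod_word p (m - 3) @ [1,0,1], prod_word p (m - 3) @ [0,0,1]) | p. True}))
   \<and> (m \<ge> 4 \<longrightarrow> \<not> finitely_presented S mul)
   \<and> (\<forall>n\<ge>1.
        growth (B m) n =
          (\<Sum>i=0..m - 2. n choose i) +
          (\<Sum>i=0..\<lfloor>(real n - real m + 1) / 2\<rfloor>. ibinom (int n - 2 * i - 1) (m - 2))
      \<and> growth (B m) n =
          (\<Sum>i=0..m - 2. n choose i) +
          (\<Sum>i::nat. ibinom (int n - 2 * int i - 1) (m - 2)))"
proof (intro conjI impI allI)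
  have P: "semigroup_presentation S mul {0, 1} f (rels m)"
    using presentation_B[OF assms(1)] by (simp add: S_def mul_def f_def)
  show "semigroup_presentation S mul {0, 1} f {([1,1,1], [0,1,1]), ([1,0,1], [0,0,1])}" if "m = 3"
    using P that by (simp add: rels_def rels3_def)
  show "semigroup_presentation S mul {0, 1} f ({([1,1,1,1], [1,0,1,1])} \<union>
      {([1] @ replicate p 0 @ [1,0,1], [1] @ replicate (p + 2) 0 @ [1]) | p. True})" if "m = 4"
    using P unfolding that rels_4 .
  show "semigroup_presentation S mul {0, 1} f
      ({(prod_word p (m - 4) @ [1,1,1,1], prod_word p (m - 4) @ [1,0,1,1]) | p. True} \<union>
       {(prod_word p (m - 3) @ [1,0,1], prod_word p (m - 3) @ [0,0,1]) | p. True})" if "m \<ge> 5"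
    using P that by (simp add: rels_def)
  show "\<not> finitely_presented S mul" if "m \<ge> 4"
    using not_finitely_presented_B[OF that] by (simp add: S_def mul_def)
  fix n :: nat assume "n \<ge> 1"
  then have "growth (B m) n = (\<Sum>i=0..m - 2. n choose i) +
      (\<Sum>j | 2 * j + 1 \<le> n. (n - 2 * j - 1) choose (m - 2))"
    using growth_B card_normal assms(1) by simp
  then show "growth (B m) n = (\<Sum>i=0..m - 2. n choose i) +
        (\<Sum>i=0..\<lfloor>(real n - real m + 1) / 2\<rfloor>. ibinom (int n - 2 * i - 1) (m - 2))"
    and "growth (B m) n = (\<Sum>i=0..m - 2. n choose i) +
        (\<Sum>i::nat. ibinom (int n - 2 * int i - 1) (m - 2))"
    unfolding sum_ibinom_floor[OF assms(1)] suminf_ibinom by simp_all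
qed

end
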